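(* In the case of Gardner–Morikawa exponents $\alpha=\beta=q=k$, the lowest-order $\epsilon$-dependent terms of the dimensionless bubbly fluid equations given in the context (without gravity) are satisfied by the first two terms of the expansions given in the context, where $\rho^{(1)}(\xi,\tau)$ is an arbitrary solution of the Burgers equation $$\rho^{(1)}_\tau=A\,\rho^{(1)}_{\xi\xi}+B\,\rho^{(1)}\rho^{(1)}_\xi,$$ $$A=\frac{\left[P_0^2R_0^4+\frac{13}{3}R_0^3T_0+\left(P_0^2R_0+\frac43T_0\right)(1-X)\right](R_0^3-X+1)}{6R_0^3T_0},\qquad B=-\frac{P_0^{1/2}(R_0^3-X+1)^3}{R_0^{9/2}},$$ and the remaining state variable perturbations $u^{(1)},P^{(1)},P_2^{(1)},R^{(1)},u^{(2)},P^{(2)},P_2^{(2)},R^{(2)}$ are determined by the relationships $$u^{(1)}_\xi=\frac{a_0}{\rho_0}\rho^{(1)}_\xi,\quad P^{(1)}=P_2^{(1)},\quad P_2^{(1)}=-\frac{3P_0}{R_0}R^{(1)},\quad R^{(1)}=-\frac{(R_0^3-X+1)^2}{3R_0^2}\rho^{(1)},\quad P^{(1)}_\xi=\rho_0a_0\,u^{(1)}_\xi,$$ and $$u^{(2)}_\xi=\frac{a_0}{\rho_0}\rho^{(2)}_\xi-\frac1{\rho_0}\left(\rho^{(1)}_\tau+\frac{2a_0}{\rho_0}\rho^{(1)}\rho^{(1)}_\xi\right),\qquad P^{(2)}=P_2^{(2)}+\frac{4a_0}{3R_0}R^{(1)}_\xi,$$ $$P_2^{(2)}=-\frac{3P_0}{R_0}R^{(2)}+\frac{a_0P_0^2}{T_0}R^{(1)}_\xi+\frac{6P_0}{R_0^2}\bigl(R^{(1)}\bigr)^2,$$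 $$R^{(2)}=-\frac{(R_0^3-X+1)^2}{3R_0^2}\rho^{(2)}+\frac{(2R_0^3+X-1)(R_0^3-X+1)^3}{9R_0^5}\bigl(\rho^{(1)}\bigr)^2.$$
   Context: The dimensionless one-dimensional bubbly fluid model without gravity, for the fields $\rho$ (mixture density), $u$ (velocity), $P$ (mixture pressure), $P_2$ (gas pressure), $R$ (bubble radius), is $$\rho_t+(\rho u)_x=0,\qquad(\rho u)_t+(\rho u^2+P)_x-u_{xx}=0,$$ $$P=P_2-\left(R\,\mathcal{D}_t^2R+\tfrac32(\mathcal{D}_tR)^2+\tfrac43\frac{\mathcal{D}_tR}{R}\right),$$ $$\mathcal{D}_tP_2+3\gamma P_2\frac{\mathcal{D}_tR}{R}+3(\gamma-1)\frac{T_0}{R}\left(\frac{P_2}{P_0}\frac{R^3}{R_0^3}-1\right)=0,\qquad(1-X+R^3)\rho-1=0,$$ with $\mathcal{D}_t=\partial_t+u\,\partial_x$, gas mass fraction $X$, adiabatic exponent $\gamma$, and constants $P_0,T_0,R_0$ (initial pressure, temperature, radius). The fields are expanded in generalized power series in a small parameter $\epsilon$ about a constant static equilibrium: $$\rho=\rho_0+\epsilon^q\rho^{(1)}+\epsilon^{q+k}\rho^{(2)}+\dots,\quad u=0+\epsilon^qu^{(1)}+\epsilon^{q+k}u^{(2)}+\dots,\quad R=R_0+\epsilon^qR^{(1)}+\epsilon^{q+k}R^{(2)}+\dots,$$ $$P=P_0+\epsilon^qP^{(1)}+\epsilon^{q+k}P^{(2)}+\dots,\quad P_2=P_0+\epsilon^qP_2^{(1)}+\epsilon^{q+k}P_2^{(2)}+\dots,$$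 where $\rho_0=1/(R_0^3-X+1)$ and the coefficients are functions of the Gardner–Morikawa variables $$\xi=\epsilon^\alpha(x-a_0t),\qquad\tau=\epsilon^{\alpha+\beta}t,\qquad a_0=R_0^{-3/2}P_0^{1/2}(R_0^3-X+1),$$ with positive constants $\alpha,\beta,q,k$. Subscripts $\xi,\tau$ denote partial derivatives.
   Formalization: The function of τ left free by the relation for u^(1)_ξ is taken to be zero, i.e. u^(1) = (a_0/ρ_0)ρ^(1); with u^(1) = (a_0/ρ_0)ρ^(1) + c(τ) the second-order mass equation leaves the term c(τ)ρ^(1)_ξ, which is not zero in general. *)

theory Defs
  imports "HOL-Analysis.Analysis" "HOL-Library.Landau_Symbols"
begin

text \<open>Functions of two variables are curried. The same operators serve for \<open>(x, t)\<close> and for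
  \<open>(\<xi>, \<tau>)\<close>: \<open>partial1\<close> is the spatial and \<open>partial2\<close> the temporal derivative.\<close>

definition partial1 :: "(real \<Rightarrow> real \<Rightarrow> real) \<Rightarrow> real \<Rightarrow> real \<Rightarrow> real" where
  "partial1 f x t = deriv (\<lambda>s. f s t) x"

definition partial2 :: "(real \<Rightarrow> real \<Rightarrow> real) \<Rightarrow> real \<Rightarrow> real \<Rightarrow> real" where
  "partial2 f x t = deriv (\<lambda>s. f x s) t"

text \<open>Because \<open>deriv\<close> is total, regularity is a separate requirement: \<open>f\<close> and its two
  first partial derivatives are Frechet differentiable.\<close>

definition twice_differentiable_on2 :: "(real \<Rightarrow> real \<Rightarrow> real) \<Rightarrow> (real \<times> real) set \<Rightarrow> bool" where
  "twice_differentiable_on2 f \<Omega> \<longleftrightarrow>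
     (\<forall>p\<in>\<Omega>. (\<lambda>(x, t). f x t) differentiable (at p) \<and>
            (\<lambda>(x, t). partial1 f x t) differentiable (at p) \<and>
            (\<lambda>(x, t). partial2 f x t) differentiable (at p))"

definition material_deriv ::
  "(real \<Rightarrow> real \<Rightarrow> real) \<Rightarrow> (real \<Rightarrow> real \<Rightarrow> real) \<Rightarrow> real \<Rightarrow> real \<Rightarrow> real" where
  "material_deriv u f x t = partial2 f x t + u x t * partial1 f x t"

text \<open>The five model equations, each as left-hand side minus right-hand side.\<close>

definition mass_residual ::
  "(real \<Rightarrow> real \<Rightarrow> real) \<Rightarrow> (real \<Rightarrow> real \<Rightarrow> real) \<Rightarrow> real \<Rightarrow> real \<Rightarrow> real" where
  "mass_residual \<rho> u x t = partial2 \<rho> x t + partial1 (\<lambda>x t. \<rho> x t * u x t) x t"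

definition momentum_residual ::
  "(real \<Rightarrow> real \<Rightarrow> real) \<Rightarrow> (real \<Rightarrow> real \<Rightarrow> real) \<Rightarrow> (real \<Rightarrow> real \<Rightarrow> real) \<Rightarrow> real \<Rightarrow> real \<Rightarrow> real" where
  "momentum_residual \<rho> u P x t =
     partial2 (\<lambda>x t. \<rho> x t * u x t) x t
     + partial1 (\<lambda>x t. \<rho> x t * (u x t)\<^sup>2 + P x t) x t
     - partial1 (partial1 u) x t"

definition pressure_residual ::
  "(real \<Rightarrow> real \<Rightarrow> real) \<Rightarrow> (real \<Rightarrow> real \<Rightarrow> real) \<Rightarrow> (real \<Rightarrow> real \<Rightarrow> real) \<Rightarrow> (real \<Rightarrow> real \<Rightarrow> real)
    \<Rightarrow> real \<Rightarrow> real \<Rightarrow> real" where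
  "pressure_residual u P P2 R x t =
     P x t - (P2 x t - (R x t * material_deriv u (material_deriv u R) x t
                        + 3/2 * (material_deriv u R x t)\<^sup>2
                        + 4/3 * (material_deriv u R x t / R x t)))"

definition gas_residual ::
  "real \<Rightarrow> real \<Rightarrow> real \<Rightarrow> real \<Rightarrow> (real \<Rightarrow> real \<Rightarrow> real) \<Rightarrow> (real \<Rightarrow> real \<Rightarrow> real) \<Rightarrow> (real \<Rightarrow> real \<Rightarrow> real)
    \<Rightarrow> real \<Rightarrow> real \<Rightarrow> real" where
  "gas_residual \<gamma> P0 T0 R0 u P2 R x t =
     material_deriv u P2 x t
     + 3 * \<gamma> * P2 x t * (material_deriv u R x t / R x t)
     + 3 * (\<gamma> - 1) * (T0 / R x t) * ((P2 x t / P0) * ((R x t) ^ 3 / R0 ^ 3) - 1)"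

definition density_residual ::
  "real \<Rightarrow> (real \<Rightarrow> real \<Rightarrow> real) \<Rightarrow> (real \<Rightarrow> real \<Rightarrow> real) \<Rightarrow> real \<Rightarrow> real \<Rightarrow> real" where
  "density_residual X \<rho> R x t = (1 - X + (R x t) ^ 3) * \<rho> x t - 1"

text \<open>The expansion in generalized powers of \<open>\<epsilon>\<close> about the constant \<open>f0\<close>, in the
  Gardner-Morikawa variables, up to and including the coefficient \<open>f N\<close>. The formal series is
  represented by all its partial sums; \<open>f 0\<close> is not used.\<close>

definition gm_expansion ::
  "real \<Rightarrow> real \<Rightarrow> real \<Rightarrow> real \<Rightarrow> real \<Rightarrow> nat \<Rightarrow> real \<Rightarrow> (nat \<Rightarrow> real \<Rightarrow> real \<Rightarrow> real)
    \<Rightarrow> real \<Rightarrow> real \<Rightarrow> real \<Rightarrow> real" where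
  "gm_expansion \<alpha> \<beta> q k a0 N f0 f \<epsilon> x t =
     f0 + (\<Sum>n=1..N. \<epsilon> powr (q + (real n - 1) * k)
                     * f n (\<epsilon> powr \<alpha> * (x - a0 * t)) (\<epsilon> powr (\<alpha> + \<beta>) * t))"

text \<open>An \<open>\<epsilon>\<close>-dependent expression in \<open>(x, t)\<close>, read as a function of \<open>\<epsilon>\<close> at a fixed
  value of the Gardner-Morikawa variables: \<open>t = \<tau> / \<epsilon>\<^sup>\<alpha>\<^sup>+\<^sup>\<beta>\<close> and \<open>x = \<xi> / \<epsilon>\<^sup>\<alpha> + a0 t\<close>.\<close>

definition at_gm ::
  "real \<Rightarrow> real \<Rightarrow> real \<Rightarrow> (real \<Rightarrow> real \<Rightarrow> real \<Rightarrow> real) \<Rightarrow> real \<Rightarrow> real \<Rightarrow> real \<Rightarrow> real" where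
  "at_gm \<alpha> \<beta> a0 E \<xi> \<tau> \<epsilon> =
     E \<epsilon> (\<xi> / \<epsilon> powr \<alpha> + a0 * (\<tau> / \<epsilon> powr (\<alpha> + \<beta>))) (\<tau> / \<epsilon> powr (\<alpha> + \<beta>))"

text \<open>\<open>f \<epsilon> = c1 \<epsilon>\<^sup>p + c2 \<epsilon>\<^sup>p\<^sup>+\<^sup>k + O(\<epsilon>\<^sup>p\<^sup>+\<^sup>2\<^sup>k)\<close> as \<open>\<epsilon>\<close> tends to \<open>0\<close> from above. For
  \<open>k > 0\<close> the coefficients \<open>c1\<close> and \<open>c2\<close> are unique.\<close>

definition lowest_terms :: "real \<Rightarrow> real \<Rightarrow> (real \<Rightarrow> real) \<Rightarrow> real \<Rightarrow> real \<Rightarrow> bool" where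
  "lowest_terms p k f c1 c2 \<longleftrightarrow>
     (\<lambda>\<epsilon>. f \<epsilon> - (c1 * \<epsilon> powr p + c2 * \<epsilon> powr (p + k))) \<in> O[at_right 0](\<lambda>\<epsilon>. \<epsilon> powr (p + 2 * k))"

end

theory Submission
  imports Defs "HOL-Real_Asymp.Real_Asymp"
begin

text \<open>With all exponents equal, put \<open>e = \<epsilon>\<^sup>\<alpha>\<close>. In the Gardner-Morikawa variables the fields become
  polynomials in \<open>e\<close>, \<open>\<partial>\<^sub>x = e \<partial>\<^sub>\<xi>\<close> and \<open>\<partial>\<^sub>t = - a0 e \<partial>\<^sub>\<xi> + e\<^sup>2 \<partial>\<^sub>\<tau>\<close>, so at a fixed \<open>(\<xi>, \<tau>)\<close> every residual is
  an algebraic expression in \<open>e\<close> and can be expanded by arithmetic on second-order jets at \<open>e = 0\<close>. The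
  relations among the perturbations annihilate the jets of the mass, pressure, gas and density equations.
  Substituting them into the second-order momentum balance turns it into an equation for \<open>\<rho> 1\<close> alone, in
  which the \<open>\<rho> 2\<close> terms cancel because \<open>a0\<^sup>2 = P0 D\<^sup>2 / R0\<^sup>3\<close> with \<open>D = R0\<^sup>3 - X + 1\<close>; it is the
  Burgers equation multiplied by \<open>2 a0\<close>.\<close>

section \<open>Second-order jets at zero from the right\<close>

text \<open>The expansion is required at every \<open>e > 0\<close>, with only the boundedness of
  \<open>h\<close> asymptotic. Arithmetic on jets is then pointwise algebra, and Landau reasoning is
  confined to the remainder. Order two suffices because \<open>lowest_terms\<close> asks for exactly
  two coefficients.\<close>

definition jet :: "(real \<Rightarrow> real) \<Rightarrow> real \<Rightarrow> real \<Rightarrow> real \<Rightarrow> bool" where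
  "jet f c0 c1 c2 \<longleftrightarrow> (\<exists>h. h \<in> O[at_right 0](\<lambda>_. 1) \<and> (\<forall>e>0. f e = c0 + c1 * e + c2 * e\<^sup>2 + e ^ 3 * h e))"

lemma jetI:
  assumes "h \<in> O[at_right 0](\<lambda>_. 1)"
    and "\<And>e. 0 < e \<Longrightarrow> f e = c0 + c1 * e + c2 * e\<^sup>2 + e ^ 3 * h e"
  shows "jet f c0 c1 c2"
  using assms unfolding jet_def by blast

lemma ident_bigo_1: "(\<lambda>e::real. e) \<in> O[at_right 0](\<lambda>_. 1)"
  by real_asymp

lemma const_bigo_1: "(\<lambda>e::real. c::real) \<in> O[at_right 0](\<lambda>_. 1)"
  by simp

lemmas bounded_intros = sum_in_bigo(1) landau_o.big.mult_in_1 ident_bigo_1 const_bigo_1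

lemma jet_const: "jet (\<lambda>_. c) c 0 0"
  by (rule jetI[of "\<lambda>_. 0"]) auto

lemma jet_ident: "jet (\<lambda>e. e) 0 1 0"
  by (rule jetI[of "\<lambda>_. 0"]) auto

lemma jet_add:
  assumes "jet f a0 a1 a2" "jet g b0 b1 b2"
  shows "jet (\<lambda>e. f e + g e) (a0 + b0) (a1 + b1) (a2 + b2)"
proof -
  obtain h k where "h \<in> O[at_right 0](\<lambda>_. 1)" "\<forall>e>0. f e = a0 + a1 * e + a2 * e\<^sup>2 + e ^ 3 * h e"
    "k \<in> O[at_right 0](\<lambda>_. 1)" "\<forall>e>0. g e = b0 + b1 * e + b2 * e\<^sup>2 + e ^ 3 * k e"
    using assms unfolding jet_def by blast
  then show ?thesis
    by (intro jetI[of "\<lambda>e. h e + k e"]) (auto simp: algebra_simps intro: sum_in_bigo)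
qed

lemma jet_mult:
  assumes "jet f a0 a1 a2" "jet g b0 b1 b2"
  shows "jet (\<lambda>e. f e * g e) (a0 * b0) (a0 * b1 + a1 * b0) (a0 * b2 + a1 * b1 + a2 * b0)"
proof -
  obtain h k where h: "h \<in> O[at_right 0](\<lambda>_. 1)" "\<forall>e>0. f e = a0 + a1 * e + a2 * e\<^sup>2 + e ^ 3 * h e"
    and k: "k \<in> O[at_right 0](\<lambda>_. 1)" "\<forall>e>0. g e = b0 + b1 * e + b2 * e\<^sup>2 + e ^ 3 * k e"
    using assms unfolding jet_def by blast
  \<comment> \<open>All products of total degree at least 3, divided by \<open>e ^ 3\<close>. Powers
    are spelled \<open>e * e\<close> so that \<open>bounded_intros\<close> can split them into
    bounded factors.\<close>
  let ?m = "\<lambda>e. (a1 * b2 + a2 * b1) + a2 * b2 * e + h e * (b0 + b1 * e + b2 * (e * e))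
              + k e * (a0 + a1 * e + a2 * (e * e)) + h e * k e * (e * (e * e))"
  show ?thesis
  proof (rule jetI)
    show "?m \<in> O[at_right 0](\<lambda>_. 1)"
      by (intro bounded_intros h k)
    show "f e * g e = a0 * b0 + (a0 * b1 + a1 * b0) * e + (a0 * b2 + a1 * b1 + a2 * b0) * e\<^sup>2
            + e ^ 3 * ?m e" if "0 < e" for e
      using h(2) k(2) that by (simp add: algebra_simps power2_eq_square power3_eq_cube)
  qed
qed

lemma jet_minus: "jet f a0 a1 a2 \<Longrightarrow> jet (\<lambda>e. - f e) (- a0) (- a1) (- a2)"
  using jet_mult[OF jet_const[of "-1"]] by fastforce

lemma jet_diff:
  "jet f a0 a1 a2 \<Longrightarrow> jet g b0 b1 b2 \<Longrightarrow> jet (\<lambda>e. f e - g e) (a0 - b0) (a1 - b1) (a2 - b2)"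
  using jet_add[OF _ jet_minus] by fastforce

lemma jet_power2:
  "jet f a0 a1 a2 \<Longrightarrow> jet (\<lambda>e. (f e)\<^sup>2) (a0 * a0) (a0 * a1 + a1 * a0) (a0 * a2 + a1 * a1 + a2 * a0)"
  unfolding power2_eq_square by (rule jet_mult)

lemma jet_power3:
  assumes "jet f a0 a1 a2"
  shows "jet (\<lambda>e. f e ^ 3) (a0 ^ 3) (3 * a0\<^sup>2 * a1) (3 * a0\<^sup>2 * a2 + 3 * a0 * a1\<^sup>2)"
  using jet_mult[OF jet_mult[OF assms assms] assms]
  by (simp add: power2_eq_square power3_eq_cube algebra_simps)

lemma jet_tendsto:
  assumes "jet f a0 a1 a2"
  shows "(f \<longlongrightarrow> a0) (at_right 0)"
proof -
  obtain h where h: "h \<in> O[at_right 0](\<lambda>_. 1)" "\<forall>e>0. f e = a0 + a1 * e + a2 * e\<^sup>2 + e ^ 3 * h e"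
    using assms unfolding jet_def by blast
  have "(\<lambda>e. e ^ 3) \<in> o[at_right 0](\<lambda>_. 1::real)" by real_asymp
  then have "(\<lambda>e. e ^ 3 * h e) \<in> o[at_right 0](\<lambda>_. 1 * 1)"
    using h(1) by (rule landau_o.small_big_mult)
  then have "((\<lambda>e. e ^ 3 * h e) \<longlongrightarrow> 0) (at_right 0)"
    using smalloD_tendsto by fastforce
  then have "((\<lambda>e. a0 + a1 * e + a2 * e\<^sup>2 + e ^ 3 * h e) \<longlongrightarrow> a0 + a1 * 0 + a2 * 0\<^sup>2 + 0) (at_right 0)"
    by (intro tendsto_intros)
  moreover have "\<forall>\<^sub>F e in at_right 0. a0 + a1 * e + a2 * e\<^sup>2 + e ^ 3 * h e = f e"
    using h(2) by (auto simp: eventually_at_right_less intro: eventually_mono[OF eventually_at_right_less])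
  ultimately show ?thesis by (simp add: tendsto_cong)
qed

text \<open>The polynomial \<open>b\<close> inverts the jet of \<open>f\<close> up to second order,
  so \<open>f e * b e = 1 + e ^ 3 * h e\<close> and hence
  \<open>inverse (f e) - b e = - (e ^ 3 * h e * inverse (f e))\<close> wherever \<open>f e\<close>
  is nonzero. Since \<open>f\<close> tends to \<open>a0\<close>, which is nonzero,
  \<open>inverse (f e)\<close> is bounded near 0.\<close>

lemma jet_inverse:
  assumes f: "jet f a0 a1 a2" and nz: "a0 \<noteq> 0"
  shows "jet (\<lambda>e. inverse (f e)) (1 / a0) (- a1 / a0\<^sup>2) (a1\<^sup>2 / a0 ^ 3 - a2 / a0\<^sup>2)"
proof -
  define b where "b e = 1 / a0 + (- a1 / a0\<^sup>2) * e + (a1\<^sup>2 / a0 ^ 3 - a2 / a0\<^sup>2) * e\<^sup>2" for e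
  have "jet b (1 / a0) (- a1 / a0\<^sup>2) (a1\<^sup>2 / a0 ^ 3 - a2 / a0\<^sup>2)"
    by (rule jetI[of "\<lambda>_. 0"]) (auto simp: b_def)
  from jet_mult[OF f this] nz have "jet (\<lambda>e. f e * b e) 1 0 0"
    by (simp add: field_simps power2_eq_square power3_eq_cube)
  then obtain h where h: "h \<in> O[at_right 0](\<lambda>_. 1)" "\<forall>e>0. f e * b e = 1 + e ^ 3 * h e"
    unfolding jet_def by auto
  have lim: "(f \<longlongrightarrow> a0) (at_right 0)"
    by (rule jet_tendsto[OF f])
  then have "((\<lambda>e. inverse (f e)) \<longlongrightarrow> inverse a0) (at_right 0)"
    using nz by (rule tendsto_inverse)
  then have "(\<lambda>e. inverse (f e)) \<in> O[at_right 0](\<lambda>_. 1)"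
    by (intro bigoI_tendsto[where c = "inverse a0"]) auto
  then have bound: "(\<lambda>e. - (h e * inverse (f e))) \<in> O[at_right 0](\<lambda>_. 1)"
    using h(1) landau_o.big.mult_in_1 by (auto intro: landau_o.big.mult_in_1)
  have "\<forall>\<^sub>F e in at_right 0. f e \<noteq> 0"
    using lim nz by (rule tendsto_imp_eventually_ne)
  then have "\<forall>\<^sub>F e in at_right 0. (inverse (f e) - b e) / e ^ 3 = - (h e * inverse (f e))"
  proof (rule eventually_elim2[OF _ eventually_at_right_less])
    fix e :: real assume "f e \<noteq> 0" "0 < e"
    with h(2) have "inverse (f e) - b e = - (e ^ 3 * h e * inverse (f e))"
      by (simp add: field_simps)
    with \<open>0 < e\<close> show "(inverse (f e) - b e) / e ^ 3 = - (h e * inverse (f e))"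
      by simp
  qed
  \<comment> \<open>This quotient serves as the remainder for all \<open>e > 0\<close>. Zeros of
    \<open>f\<close> away from 0 do no harm, because its boundedness only concerns small
    \<open>e\<close>.\<close>
  with bound have "(\<lambda>e. (inverse (f e) - b e) / e ^ 3) \<in> O[at_right 0](\<lambda>_. 1)"
    by (simp add: landau_o.big.in_cong)
  then show ?thesis
    by (rule jetI) (simp add: b_def)
qed

lemma jet_divide:
  "jet f a0 a1 a2 \<Longrightarrow> jet g b0 b1 b2 \<Longrightarrow> b0 \<noteq> 0 \<Longrightarrow>
    jet (\<lambda>e. f e / g e) (a0 * (1 / b0)) (a0 * (- b1 / b0\<^sup>2) + a1 * (1 / b0))
      (a0 * (b1\<^sup>2 / b0 ^ 3 - b2 / b0\<^sup>2) + a1 * (- b1 / b0\<^sup>2) + a2 * (1 / b0))"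
  unfolding divide_inverse[of "f _"] by (intro jet_mult jet_inverse)

lemma jet_bigo:
  assumes "jet f 0 0 0"
  shows "f \<in> O[at_right 0](\<lambda>e. e ^ 3)"
proof -
  obtain h where h: "h \<in> O[at_right 0](\<lambda>_. 1)" "\<forall>e>0. f e = e ^ 3 * h e"
    using assms unfolding jet_def by auto
  have "\<forall>\<^sub>F e in at_right 0. f e = e ^ 3 * h e"
    using h(2) by (auto intro: eventually_mono[OF eventually_at_right_less])
  moreover have "(\<lambda>e. e ^ 3 * h e) \<in> O[at_right 0](\<lambda>e. e ^ 3)"
    using landau_o.big_mult[OF landau_o.big_refl h(1)] by simp
  ultimately show ?thesis by (simp add: landau_o.big.in_cong)
qed

text \<open>Separates computing from comparing: the coefficients are first synthesized by
  \<open>jet_intros\<close> as schematic terms, and their equality with the wanted values, usually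
  0, is left as plain algebra.\<close>

lemma jet_cong:
  "jet f a b c \<Longrightarrow> a = a' \<Longrightarrow> b = b' \<Longrightarrow> c = c' \<Longrightarrow> jet f a' b' c'"
  by simp

lemmas jet_intros = jet_const jet_ident jet_add jet_diff jet_minus jet_mult jet_power2 jet_power3 jet_divide

text \<open>Every term of the mass and momentum equations contains a derivative, which yields a
  common factor \<open>e\<close>; it raises the order of the remainder from 3 to 4.\<close>

lemma ident_mult_bigo:
  assumes "f \<in> O[at_right 0](\<lambda>e::real. e ^ 3)"
  shows "(\<lambda>e. e * f e) \<in> O[at_right 0](\<lambda>e. e ^ 4)"
  using landau_o.big_mult[OF landau_o.big_refl[of "\<lambda>e. e"] assms]
  by (simp add: numeral_eq_Suc)

section \<open>Calculus of partial derivatives\<close>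

definition differentiable_on2 :: "(real \<Rightarrow> real \<Rightarrow> real) \<Rightarrow> (real \<times> real) set \<Rightarrow> bool" where
  "differentiable_on2 f \<Omega> \<longleftrightarrow> (\<forall>p\<in>\<Omega>. (\<lambda>(x, t). f x t) differentiable (at p))"

lemma twice_differentiable_on2_iff:
  "twice_differentiable_on2 f \<Omega> \<longleftrightarrow>
     differentiable_on2 f \<Omega> \<and> differentiable_on2 (partial1 f) \<Omega> \<and> differentiable_on2 (partial2 f) \<Omega>"
  unfolding twice_differentiable_on2_def differentiable_on2_def by blast

lemma has_derivative_Pair_const:
  fixes x t :: real
  shows "((\<lambda>s. (s, t)) has_derivative (\<lambda>h. (h, 0))) (at x)"
    and "((\<lambda>s. (x, s)) has_derivative (\<lambda>h. (0, h))) (at t)"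
  by (auto intro!: derivative_eq_intros)

text \<open>A linear map on the plane is determined by its values at the unit vectors, and
  restricting to the two coordinate lines identifies these with the partial derivatives. The total
  derivative in this explicit form is what the chain rule along the moving frame needs.\<close>

lemma differentiable_on2_has_derivative:
  assumes "differentiable_on2 f \<Omega>" "(x, t) \<in> \<Omega>"
  shows "((\<lambda>p. f (fst p) (snd p)) has_derivative
           (\<lambda>v. partial1 f x t * fst v + partial2 f x t * snd v)) (at (x, t))"
proof -
  have "(\<lambda>p. f (fst p) (snd p)) differentiable (at (x, t))"
    using assms unfolding differentiable_on2_def by (auto simp: case_prod_unfold)
  then obtain L where L: "((\<lambda>p. f (fst p) (snd p)) has_derivative L) (at (x, t))"
    unfolding differentiable_def by blast
  interpret L: linear L
    using L by (rule has_derivative_linear)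
  have "((\<lambda>s. f s t) has_derivative (\<lambda>h. L (h, 0))) (at x)"
    using has_derivative_compose[OF has_derivative_Pair_const(1) L] by simp
  moreover have "(\<lambda>h. L (h, 0)) = (*) (L (1, 0))"
  proof
    fix h
    have "L (h, 0) = L (h *\<^sub>R (1, 0))" by simp
    also have "\<dots> = L (1, 0) * h" unfolding L.scale by simp
    finally show "L (h, 0) = L (1, 0) * h" .
  qed
  ultimately have "((\<lambda>s. f s t) has_field_derivative L (1, 0)) (at x)"
    by (simp add: has_field_derivative_def)
  then have 1: "partial1 f x t = L (1, 0)"
    unfolding partial1_def by (rule DERIV_imp_deriv)
  have "((\<lambda>s. f x s) has_derivative (\<lambda>h. L (0, h))) (at t)"
    using has_derivative_compose[OF has_derivative_Pair_const(2) L] by simp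
  moreover have "(\<lambda>h. L (0, h)) = (*) (L (0, 1))"
  proof
    fix h
    have "L (0, h) = L (h *\<^sub>R (0, 1))" by simp
    also have "\<dots> = L (0, 1) * h" unfolding L.scale by simp
    finally show "L (0, h) = L (0, 1) * h" .
  qed
  ultimately have "((\<lambda>s. f x s) has_field_derivative L (0, 1)) (at t)"
    by (simp add: has_field_derivative_def)
  then have 2: "partial2 f x t = L (0, 1)"
    unfolding partial2_def by (rule DERIV_imp_deriv)
  have "L v = partial1 f x t * fst v + partial2 f x t * snd v" for v
  proof -
    have "L v = L (fst v *\<^sub>R (1, 0) + snd v *\<^sub>R (0, 1))"
      by simp
    also have "\<dots> = partial1 f x t * fst v + partial2 f x t * snd v"
      unfolding L.add L.scale 1 2 by simp
    finally show ?thesis .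
  qed
  then have "L = (\<lambda>v. partial1 f x t * fst v + partial2 f x t * snd v)"
    by blast
  with L show ?thesis by (simp only:)
qed

lemma partial1_has_derivative:
  assumes "differentiable_on2 f \<Omega>" "(x, t) \<in> \<Omega>"
  shows "((\<lambda>s. f s t) has_field_derivative partial1 f x t) (at x)"
  using has_derivative_compose[OF has_derivative_Pair_const(1) differentiable_on2_has_derivative[OF assms]]
  by (simp add: has_field_derivative_def)

lemma partial2_has_derivative:
  assumes "differentiable_on2 f \<Omega>" "(x, t) \<in> \<Omega>"
  shows "((\<lambda>s. f x s) has_field_derivative partial2 f x t) (at t)"
  using has_derivative_compose[OF has_derivative_Pair_const(2) differentiable_on2_has_derivative[OF assms]]
  by (simp add: has_field_derivative_def)

lemma partial1_eqI: "((\<lambda>s. f s t) has_field_derivative d) (at x) \<Longrightarrow> partial1 f x t = d"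
  unfolding partial1_def by (rule DERIV_imp_deriv)

lemma partial2_eqI: "((\<lambda>s. f x s) has_field_derivative d) (at t) \<Longrightarrow> partial2 f x t = d"
  unfolding partial2_def by (rule DERIV_imp_deriv)

text \<open>The relations between the fields hold only on an open set. Its coordinate slices are
  open, so the two functions agree near the point on each slice; this licenses rewriting under a
  partial derivative.\<close>

lemma partial_cong:
  assumes "open S" "(x, t) \<in> S" "\<And>y s. (y, s) \<in> S \<Longrightarrow> f y s = g y s"
  shows "partial1 f x t = partial1 g x t" "partial2 f x t = partial2 g x t"
proof -
  have "open ((\<lambda>y. (y, t)) -` S)" "open ((\<lambda>s. (x, s)) -` S)"
    using \<open>open S\<close> by (auto intro!: open_vimage continuous_intros)
  then have "\<forall>\<^sub>F y in nhds x. f y t = g y t" "\<forall>\<^sub>F s in nhds t. f x s = g x s"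
    using assms(2,3) by (auto simp: eventually_nhds)
  then show "partial1 f x t = partial1 g x t" "partial2 f x t = partial2 g x t"
    unfolding partial1_def partial2_def by (auto intro: deriv_cong_ev)
qed

lemma differentiable_on2_cong:
  assumes "open \<Omega>" "\<And>x t. (x, t) \<in> \<Omega> \<Longrightarrow> f x t = g x t" "differentiable_on2 g \<Omega>"
  shows "differentiable_on2 f \<Omega>"
  unfolding differentiable_on2_def
proof
  fix p assume p: "p \<in> \<Omega>"
  then obtain D where "((\<lambda>(x, t). g x t) has_derivative D) (at p)"
    using assms(3) unfolding differentiable_on2_def differentiable_def by blast
  then have "((\<lambda>(x, t). f x t) has_derivative D) (at p)"
    by (rule has_derivative_transform_within_open[OF _ assms(1) p]) (auto simp: assms(2))
  then show "(\<lambda>(x, t). f x t) differentiable (at p)"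
    unfolding differentiable_def by blast
qed

lemma differentiable_on2_const: "differentiable_on2 (\<lambda>_ _. c) \<Omega>"
  by (auto simp: differentiable_on2_def case_prod_unfold)

lemma differentiable_on2_add:
  "differentiable_on2 f \<Omega> \<Longrightarrow> differentiable_on2 g \<Omega> \<Longrightarrow> differentiable_on2 (\<lambda>x t. f x t + g x t) \<Omega>"
  by (auto simp: differentiable_on2_def case_prod_unfold)

lemma differentiable_on2_mult:
  "differentiable_on2 f \<Omega> \<Longrightarrow> differentiable_on2 g \<Omega> \<Longrightarrow> differentiable_on2 (\<lambda>x t. f x t * g x t) \<Omega>"
  by (auto simp: differentiable_on2_def case_prod_unfold)

lemma differentiable_on2_sum:
  "(\<And>n. n \<in> I \<Longrightarrow> differentiable_on2 (f n) \<Omega>) \<Longrightarrow> differentiable_on2 (\<lambda>x t. \<Sum>n\<in>I. f n x t) \<Omega>"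
  by (induction I rule: infinite_finite_induct)
     (auto intro: differentiable_on2_const differentiable_on2_add)

lemmas differentiable_on2_intros =
  differentiable_on2_const differentiable_on2_add differentiable_on2_mult differentiable_on2_sum

lemma partial_const: "partial1 (\<lambda>_ _. c) x t = 0" "partial2 (\<lambda>_ _. c) x t = 0"
  by (auto intro: partial1_eqI partial2_eqI)

lemma partial_add:
  assumes "differentiable_on2 f \<Omega>" "differentiable_on2 g \<Omega>" "(x, t) \<in> \<Omega>"
  shows "partial1 (\<lambda>x t. f x t + g x t) x t = partial1 f x t + partial1 g x t"
    and "partial2 (\<lambda>x t. f x t + g x t) x t = partial2 f x t + partial2 g x t"
  using assms by (auto intro!: partial1_eqI partial2_eqI DERIV_add
      intro: partial1_has_derivative partial2_has_derivative)

lemma partial_mult: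
  assumes "differentiable_on2 f \<Omega>" "differentiable_on2 g \<Omega>" "(x, t) \<in> \<Omega>"
  shows "partial1 (\<lambda>x t. f x t * g x t) x t = partial1 f x t * g x t + f x t * partial1 g x t"
    and "partial2 (\<lambda>x t. f x t * g x t) x t = partial2 f x t * g x t + f x t * partial2 g x t"
proof -
  show "partial1 (\<lambda>x t. f x t * g x t) x t = partial1 f x t * g x t + f x t * partial1 g x t"
    using DERIV_mult[OF partial1_has_derivative[OF assms(1,3)] partial1_has_derivative[OF assms(2,3)]]
    by (intro partial1_eqI) (simp add: mult.commute)
  show "partial2 (\<lambda>x t. f x t * g x t) x t = partial2 f x t * g x t + f x t * partial2 g x t"
    using DERIV_mult[OF partial2_has_derivative[OF assms(1,3)] partial2_has_derivative[OF assms(2,3)]]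
    by (intro partial2_eqI) (simp add: mult.commute)
qed

lemma partial_cmult:
  assumes "differentiable_on2 f \<Omega>" "(x, t) \<in> \<Omega>"
  shows "partial1 (\<lambda>x t. c * f x t) x t = c * partial1 f x t"
    and "partial2 (\<lambda>x t. c * f x t) x t = c * partial2 f x t"
  using partial_mult[OF differentiable_on2_const assms] by (simp_all add: partial_const)

section \<open>Truncated expansions as polynomials in \<open>e\<close>, and their jets\<close>

definition eps_sum :: "nat \<Rightarrow> real \<Rightarrow> real \<Rightarrow> (nat \<Rightarrow> real \<Rightarrow> real \<Rightarrow> real) \<Rightarrow> real \<Rightarrow> real \<Rightarrow> real" where
  "eps_sum N c e f \<xi> \<tau> = c + (\<Sum>n=1..N. e ^ n * f n \<xi> \<tau>)"

lemma differentiable_on2_eps_sum: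
  "(\<And>n. n \<in> {1..N} \<Longrightarrow> differentiable_on2 (f n) \<Omega>) \<Longrightarrow> differentiable_on2 (eps_sum N c e f) \<Omega>"
  unfolding eps_sum_def [abs_def] by (intro differentiable_on2_intros) auto

lemma partial_eps_sum:
  assumes "\<And>n. n \<in> {1..N} \<Longrightarrow> differentiable_on2 (f n) \<Omega>" "(\<xi>, \<tau>) \<in> \<Omega>"
  shows "partial1 (eps_sum N c e f) \<xi> \<tau> = eps_sum N 0 e (\<lambda>n. partial1 (f n)) \<xi> \<tau>"
    and "partial2 (eps_sum N c e f) \<xi> \<tau> = eps_sum N 0 e (\<lambda>n. partial2 (f n)) \<xi> \<tau>"
proof -
  have "((\<lambda>s. c + (\<Sum>n=1..N. e ^ n * f n s \<tau>)) has_field_derivative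
      0 + (\<Sum>n=1..N. e ^ n * partial1 (f n) \<xi> \<tau>)) (at \<xi>)"
    using assms by (intro DERIV_add DERIV_const DERIV_sum DERIV_cmult partial1_has_derivative)
  then show "partial1 (eps_sum N c e f) \<xi> \<tau> = eps_sum N 0 e (\<lambda>n. partial1 (f n)) \<xi> \<tau>"
    unfolding eps_sum_def [abs_def] by (rule partial1_eqI)
  have "((\<lambda>s. c + (\<Sum>n=1..N. e ^ n * f n \<xi> s)) has_field_derivative
      0 + (\<Sum>n=1..N. e ^ n * partial2 (f n) \<xi> \<tau>)) (at \<tau>)"
    using assms by (intro DERIV_add DERIV_const DERIV_sum DERIV_cmult partial2_has_derivative)
  then show "partial2 (eps_sum N c e f) \<xi> \<tau> = eps_sum N 0 e (\<lambda>n. partial2 (f n)) \<xi> \<tau>"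
    unfolding eps_sum_def [abs_def] by (rule partial2_eqI)
qed

lemma eps_sum_split:
  assumes "2 \<le> N"
  shows "eps_sum N c e f \<xi> \<tau> = c + f 1 \<xi> \<tau> * e + f 2 \<xi> \<tau> * e\<^sup>2
      + e ^ 3 * (\<Sum>n=3..N. f n \<xi> \<tau> * e ^ (n - 3))"
proof -
  define S where "S = (\<Sum>n=3..N. f n \<xi> \<tau> * e ^ (n - 3))"
  have "{1..N} = insert 1 (insert 2 {3..N})"
    using assms by auto
  then have "(\<Sum>n=1..N. e ^ n * f n \<xi> \<tau>) = (\<Sum>n\<in>insert 1 (insert 2 {3..N}). e ^ n * f n \<xi> \<tau>)"
    by (simp only:)
  also have "\<dots> = e * f 1 \<xi> \<tau> + (e\<^sup>2 * f 2 \<xi> \<tau> + (\<Sum>n=3..N. e ^ n * f n \<xi> \<tau>))"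
    by simp
  also have "(\<Sum>n=3..N. e ^ n * f n \<xi> \<tau>) = e ^ 3 * S"
    unfolding S_def sum_distrib_left
  proof (rule sum.cong[OF refl])
    \<comment> \<open>On this range the natural-number subtraction \<open>n - 3\<close> is
      exact.\<close>
    fix n assume "n \<in> {3..N}"
    then have "e ^ n = e ^ 3 * e ^ (n - 3)"
      unfolding power_add[symmetric] by simp
    then show "e ^ n * f n \<xi> \<tau> = e ^ 3 * (f n \<xi> \<tau> * e ^ (n - 3))"
      by (rule ssubst) (simp only: mult_ac)
  qed
  finally show ?thesis
    unfolding eps_sum_def S_def[symmetric] by (simp add: algebra_simps)
qed

text \<open>From the third term on, \<open>e ^ 3\<close> factors out and a polynomial in
  \<open>e\<close> remains, which is bounded near 0. All coefficients beyond the second therefore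
  enter only the remainder, whatever the truncation \<open>N\<close>.\<close>

lemma jet_eps_sum:
  assumes "2 \<le> N"
  shows "jet (\<lambda>e. eps_sum N c e f \<xi> \<tau>) c (f 1 \<xi> \<tau>) (f 2 \<xi> \<tau>)"
proof -
  have "(\<lambda>e::real. e ^ m) \<in> O[at_right 0](\<lambda>_. 1)" for m
  proof (induction m)
    case (Suc m)
    from landau_o.big.mult_in_1[OF ident_bigo_1 this] show ?case by simp
  qed simp
  from landau_o.big.mult_in_1[OF const_bigo_1 this]
  have "(\<lambda>e. \<Sum>n=3..N. f n \<xi> \<tau> * e ^ (n - 3)) \<in> O[at_right 0](\<lambda>_. 1)"
    by (rule big_sum_in_bigo)
  then show ?thesis
    by (rule jetI) (rule eps_sum_split[OF assms])
qed

lemma twice_differentiable_on2_eps_sum: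
  assumes "open \<Omega>" "\<And>n. n \<in> {1..N} \<Longrightarrow> twice_differentiable_on2 (f n) \<Omega>"
  shows "twice_differentiable_on2 (eps_sum N c e f) \<Omega>"
  unfolding twice_differentiable_on2_iff
proof (intro conjI)
  have f: "\<And>n. n \<in> {1..N} \<Longrightarrow> differentiable_on2 (f n) \<Omega>"
    "\<And>n. n \<in> {1..N} \<Longrightarrow> differentiable_on2 (partial1 (f n)) \<Omega>"
    "\<And>n. n \<in> {1..N} \<Longrightarrow> differentiable_on2 (partial2 (f n)) \<Omega>"
    using assms(2) by (auto simp: twice_differentiable_on2_iff)
  show "differentiable_on2 (eps_sum N c e f) \<Omega>"
    by (rule differentiable_on2_eps_sum[OF f(1)])
  show "differentiable_on2 (partial1 (eps_sum N c e f)) \<Omega>"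
    by (rule differentiable_on2_cong[OF assms(1) partial_eps_sum(1)[OF f(1)] differentiable_on2_eps_sum[OF f(2)]])
  show "differentiable_on2 (partial2 (eps_sum N c e f)) \<Omega>"
    by (rule differentiable_on2_cong[OF assms(1) partial_eps_sum(2)[OF f(1)] differentiable_on2_eps_sum[OF f(3)]])
qed

text \<open>The formulas for the first derivatives hold throughout the open set
  \<open>\<Omega>\<close>, so they can be differentiated once more. The two mixed derivatives are
  treated separately, without appeal to their symmetry.\<close>

lemma partial_partial_eps_sum:
  assumes "open \<Omega>" and f: "\<And>n. n \<in> {1..N} \<Longrightarrow> twice_differentiable_on2 (f n) \<Omega>"
    and p: "(\<xi>, \<tau>) \<in> \<Omega>"
  shows "partial1 (partial1 (eps_sum N c e f)) \<xi> \<tau> = eps_sum N 0 e (\<lambda>n. partial1 (partial1 (f n))) \<xi> \<tau>"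
    and "partial2 (partial1 (eps_sum N c e f)) \<xi> \<tau> = eps_sum N 0 e (\<lambda>n. partial2 (partial1 (f n))) \<xi> \<tau>"
    and "partial1 (partial2 (eps_sum N c e f)) \<xi> \<tau> = eps_sum N 0 e (\<lambda>n. partial1 (partial2 (f n))) \<xi> \<tau>"
    and "partial2 (partial2 (eps_sum N c e f)) \<xi> \<tau> = eps_sum N 0 e (\<lambda>n. partial2 (partial2 (f n))) \<xi> \<tau>"
proof -
  have f: "\<And>n. n \<in> {1..N} \<Longrightarrow> differentiable_on2 (f n) \<Omega>"
    "\<And>n. n \<in> {1..N} \<Longrightarrow> differentiable_on2 (partial1 (f n)) \<Omega>"
    "\<And>n. n \<in> {1..N} \<Longrightarrow> differentiable_on2 (partial2 (f n)) \<Omega>"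
    using f by (auto simp: twice_differentiable_on2_iff)
  note cong1 = partial_cong[OF assms(1) p partial_eps_sum(1)[OF f(1)]]
    and cong2 = partial_cong[OF assms(1) p partial_eps_sum(2)[OF f(1)]]
  show "partial1 (partial1 (eps_sum N c e f)) \<xi> \<tau> = eps_sum N 0 e (\<lambda>n. partial1 (partial1 (f n))) \<xi> \<tau>"
    by (rule trans[OF cong1(1) partial_eps_sum(1)[OF f(2) p]])
  show "partial2 (partial1 (eps_sum N c e f)) \<xi> \<tau> = eps_sum N 0 e (\<lambda>n. partial2 (partial1 (f n))) \<xi> \<tau>"
    by (rule trans[OF cong1(2) partial_eps_sum(2)[OF f(2) p]])
  show "partial1 (partial2 (eps_sum N c e f)) \<xi> \<tau> = eps_sum N 0 e (\<lambda>n. partial1 (partial2 (f n))) \<xi> \<tau>"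
    by (rule trans[OF cong2(1) partial_eps_sum(1)[OF f(3) p]])
  show "partial2 (partial2 (eps_sum N c e f)) \<xi> \<tau> = eps_sum N 0 e (\<lambda>n. partial2 (partial2 (f n))) \<xi> \<tau>"
    by (rule trans[OF cong2(2) partial_eps_sum(2)[OF f(3) p]])
qed

lemma jet_partial_eps_sum:
  assumes "2 \<le> N" "\<And>n. n \<in> {1..N} \<Longrightarrow> differentiable_on2 (f n) \<Omega>" "(\<xi>, \<tau>) \<in> \<Omega>"
  shows "jet (\<lambda>e. partial1 (eps_sum N c e f) \<xi> \<tau>) 0 (partial1 (f 1) \<xi> \<tau>) (partial1 (f 2) \<xi> \<tau>)"
    and "jet (\<lambda>e. partial2 (eps_sum N c e f) \<xi> \<tau>) 0 (partial2 (f 1) \<xi> \<tau>) (partial2 (f 2) \<xi> \<tau>)"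
proof -
  have "partial1 (eps_sum N c e f) \<xi> \<tau> = eps_sum N 0 e (\<lambda>n. partial1 (f n)) \<xi> \<tau>"
    "partial2 (eps_sum N c e f) \<xi> \<tau> = eps_sum N 0 e (\<lambda>n. partial2 (f n)) \<xi> \<tau>" for e
    by (rule partial_eps_sum[OF assms(2,3)]; assumption)+
  then show "jet (\<lambda>e. partial1 (eps_sum N c e f) \<xi> \<tau>) 0 (partial1 (f 1) \<xi> \<tau>) (partial1 (f 2) \<xi> \<tau>)"
    "jet (\<lambda>e. partial2 (eps_sum N c e f) \<xi> \<tau>) 0 (partial2 (f 1) \<xi> \<tau>) (partial2 (f 2) \<xi> \<tau>)"
    using jet_eps_sum[OF assms(1), of 0 "\<lambda>n. partial1 (f n)" \<xi> \<tau>]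
      jet_eps_sum[OF assms(1), of 0 "\<lambda>n. partial2 (f n)" \<xi> \<tau>] by simp_all
qed

lemma jet_partial_partial_eps_sum:
  assumes "2 \<le> N" "open \<Omega>" "\<And>n. n \<in> {1..N} \<Longrightarrow> twice_differentiable_on2 (f n) \<Omega>" "(\<xi>, \<tau>) \<in> \<Omega>"
  shows "jet (\<lambda>e. partial1 (partial1 (eps_sum N c e f)) \<xi> \<tau>) 0
           (partial1 (partial1 (f 1)) \<xi> \<tau>) (partial1 (partial1 (f 2)) \<xi> \<tau>)"
    and "jet (\<lambda>e. partial2 (partial1 (eps_sum N c e f)) \<xi> \<tau>) 0
           (partial2 (partial1 (f 1)) \<xi> \<tau>) (partial2 (partial1 (f 2)) \<xi> \<tau>)"
    and "jet (\<lambda>e. partial1 (partial2 (eps_sum N c e f)) \<xi> \<tau>) 0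
           (partial1 (partial2 (f 1)) \<xi> \<tau>) (partial1 (partial2 (f 2)) \<xi> \<tau>)"
    and "jet (\<lambda>e. partial2 (partial2 (eps_sum N c e f)) \<xi> \<tau>) 0
           (partial2 (partial2 (f 1)) \<xi> \<tau>) (partial2 (partial2 (f 2)) \<xi> \<tau>)"
proof -
  have eqs: "partial1 (partial1 (eps_sum N c e f)) \<xi> \<tau> = eps_sum N 0 e (\<lambda>n. partial1 (partial1 (f n))) \<xi> \<tau>"
    "partial2 (partial1 (eps_sum N c e f)) \<xi> \<tau> = eps_sum N 0 e (\<lambda>n. partial2 (partial1 (f n))) \<xi> \<tau>"
    "partial1 (partial2 (eps_sum N c e f)) \<xi> \<tau> = eps_sum N 0 e (\<lambda>n. partial1 (partial2 (f n))) \<xi> \<tau>"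
    "partial2 (partial2 (eps_sum N c e f)) \<xi> \<tau> = eps_sum N 0 e (\<lambda>n. partial2 (partial2 (f n))) \<xi> \<tau>" for e
    by (rule partial_partial_eps_sum[OF assms(2,3,4)]; assumption)+
  show "jet (\<lambda>e. partial1 (partial1 (eps_sum N c e f)) \<xi> \<tau>) 0
           (partial1 (partial1 (f 1)) \<xi> \<tau>) (partial1 (partial1 (f 2)) \<xi> \<tau>)"
    unfolding eqs by (rule jet_eps_sum[OF assms(1)])
  show "jet (\<lambda>e. partial2 (partial1 (eps_sum N c e f)) \<xi> \<tau>) 0
           (partial2 (partial1 (f 1)) \<xi> \<tau>) (partial2 (partial1 (f 2)) \<xi> \<tau>)"
    unfolding eqs by (rule jet_eps_sum[OF assms(1)])
  show "jet (\<lambda>e. partial1 (partial2 (eps_sum N c e f)) \<xi> \<tau>) 0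
           (partial1 (partial2 (f 1)) \<xi> \<tau>) (partial1 (partial2 (f 2)) \<xi> \<tau>)"
    unfolding eqs by (rule jet_eps_sum[OF assms(1)])
  show "jet (\<lambda>e. partial2 (partial2 (eps_sum N c e f)) \<xi> \<tau>) 0
           (partial2 (partial2 (f 1)) \<xi> \<tau>) (partial2 (partial2 (f 2)) \<xi> \<tau>)"
    unfolding eqs by (rule jet_eps_sum[OF assms(1)])
qed

section \<open>The model equations in Gardner-Morikawa variables\<close>

text \<open>The Gardner-Morikawa substitution for \<open>e = \<epsilon> powr \<alpha>\<close>; time
  is scaled by the square of \<open>e\<close> because
  \<open>\<alpha> + \<beta> = 2 * \<alpha>\<close> for equal exponents.\<close>

definition gm_pull :: "real \<Rightarrow> real \<Rightarrow> (real \<Rightarrow> real \<Rightarrow> real) \<Rightarrow> real \<Rightarrow> real \<Rightarrow> real" where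
  "gm_pull a e f x t = f (e * (x - a * t)) (e\<^sup>2 * t)"

definition gm_preimage :: "real \<Rightarrow> real \<Rightarrow> (real \<times> real) set \<Rightarrow> (real \<times> real) set" where
  "gm_preimage a e \<Omega> = {(x, t). (e * (x - a * t), e\<^sup>2 * t) \<in> \<Omega>}"

lemma open_gm_preimage: "open \<Omega> \<Longrightarrow> open (gm_preimage a e \<Omega>)"
proof -
  assume "open \<Omega>"
  then have "open ((\<lambda>p. (e * (fst p - a * snd p), e\<^sup>2 * snd p)) -` \<Omega>)"
    by (intro open_vimage continuous_intros) auto
  then show ?thesis
    by (simp add: gm_preimage_def vimage_def case_prod_unfold)
qed

text \<open>The chain rule. The right-hand sides are again pullbacks, so the rule can be iterated
  and whole residuals can be moved to the variables \<open>\<xi>\<close> and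
  \<open>\<tau>\<close>.\<close>

lemma partial_gm_pull:
  assumes f: "differentiable_on2 f \<Omega>" and p: "(x, t) \<in> gm_preimage a e \<Omega>"
  shows "partial1 (gm_pull a e f) x t = gm_pull a e (\<lambda>\<xi> \<tau>. e * partial1 f \<xi> \<tau>) x t"
    and "partial2 (gm_pull a e f) x t =
           gm_pull a e (\<lambda>\<xi> \<tau>. - a * e * partial1 f \<xi> \<tau> + e\<^sup>2 * partial2 f \<xi> \<tau>) x t"
proof -
  have p: "(e * (x - a * t), e\<^sup>2 * t) \<in> \<Omega>"
    using p by (simp add: gm_preimage_def)
  note D = differentiable_on2_has_derivative[OF f p]
  let ?\<xi> = "e * (x - a * t)" and ?\<tau> = "e\<^sup>2 * t"
  have "((\<lambda>s. (e * (s - a * t), e\<^sup>2 * t)) has_derivative (\<lambda>h. (e * h, 0))) (at x)"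
    by (auto intro!: derivative_eq_intros)
  from has_derivative_compose[OF this D]
  have "((\<lambda>s. f (e * (s - a * t)) (e\<^sup>2 * t)) has_derivative
          (\<lambda>h. partial1 f ?\<xi> ?\<tau> * (e * h))) (at x)"
    by simp
  moreover have "(\<lambda>h. partial1 f ?\<xi> ?\<tau> * (e * h)) = (*) (e * partial1 f ?\<xi> ?\<tau>)"
    by (rule ext) (simp only: mult_ac)
  ultimately show "partial1 (gm_pull a e f) x t = gm_pull a e (\<lambda>\<xi> \<tau>. e * partial1 f \<xi> \<tau>) x t"
    unfolding gm_pull_def [abs_def] by (intro partial1_eqI) (simp only: has_field_derivative_def)
  have "((\<lambda>s. (e * (x - a * s), e\<^sup>2 * s)) has_derivative (\<lambda>h. (- (e * (a * h)), e\<^sup>2 * h))) (at t)"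
    by (auto intro!: derivative_eq_intros)
  from has_derivative_compose[OF this D]
  have "((\<lambda>s. f (e * (x - a * s)) (e\<^sup>2 * s)) has_derivative
          (\<lambda>h. partial1 f ?\<xi> ?\<tau> * - (e * (a * h)) + partial2 f ?\<xi> ?\<tau> * (e\<^sup>2 * h))) (at t)"
    by (simp only: fst_conv snd_conv)
  moreover have "(\<lambda>h. partial1 f ?\<xi> ?\<tau> * - (e * (a * h)) + partial2 f ?\<xi> ?\<tau> * (e\<^sup>2 * h))
      = (*) (- a * e * partial1 f ?\<xi> ?\<tau> + e\<^sup>2 * partial2 f ?\<xi> ?\<tau>)"
    by (rule ext) algebra
  ultimately show "partial2 (gm_pull a e f) x t =
           gm_pull a e (\<lambda>\<xi> \<tau>. - a * e * partial1 f \<xi> \<tau> + e\<^sup>2 * partial2 f \<xi> \<tau>) x t"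
    unfolding gm_pull_def [abs_def] by (intro partial2_eqI) (simp only: has_field_derivative_def)
qed

lemma gm_pull_mult:
  "(\<lambda>x t. gm_pull a e f x t * gm_pull a e g x t) = gm_pull a e (\<lambda>\<xi> \<tau>. f \<xi> \<tau> * g \<xi> \<tau>)"
  by (simp add: gm_pull_def [abs_def])

text \<open>The operators \<open>gm_mass\<close>, \<open>gm_momentum\<close>, \<open>gm_material\<close>, \<open>gm_pressure\<close> and \<open>gm_gas\<close> are those
  of the model transported along \<open>(x, t) \<mapsto> (e (x - a t), e\<^sup>2 t)\<close>.\<close>

definition gm_mass ::
  "real \<Rightarrow> real \<Rightarrow> (real \<Rightarrow> real \<Rightarrow> real) \<Rightarrow> (real \<Rightarrow> real \<Rightarrow> real) \<Rightarrow> real \<Rightarrow> real \<Rightarrow> real" where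
  "gm_mass a e r v \<xi> \<tau> =
     e * (- a * partial1 r \<xi> \<tau> + e * partial2 r \<xi> \<tau>
          + (partial1 r \<xi> \<tau> * v \<xi> \<tau> + r \<xi> \<tau> * partial1 v \<xi> \<tau>))"

lemma mass_residual_gm_pull:
  assumes "differentiable_on2 r \<Omega>" "differentiable_on2 v \<Omega>" and p: "(x, t) \<in> gm_preimage a e \<Omega>"
  shows "mass_residual (gm_pull a e r) (gm_pull a e v) x t = gm_pull a e (gm_mass a e r v) x t"
proof -
  have q: "(e * (x - a * t), e\<^sup>2 * t) \<in> \<Omega>"
    using p by (simp add: gm_preimage_def)
  show ?thesis
    unfolding mass_residual_def gm_pull_mult
      partial_gm_pull[OF assms(1) p] partial_gm_pull[OF differentiable_on2_mult[OF assms(1,2)] p]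
    unfolding gm_pull_def gm_mass_def partial_mult[OF assms(1,2) q]
    by (simp add: algebra_simps power2_eq_square)
qed

definition gm_momentum ::
  "real \<Rightarrow> real \<Rightarrow> (real \<Rightarrow> real \<Rightarrow> real) \<Rightarrow> (real \<Rightarrow> real \<Rightarrow> real) \<Rightarrow> (real \<Rightarrow> real \<Rightarrow> real)
    \<Rightarrow> real \<Rightarrow> real \<Rightarrow> real" where
  "gm_momentum a e r v p \<xi> \<tau> =
     e * (- a * (partial1 r \<xi> \<tau> * v \<xi> \<tau> + r \<xi> \<tau> * partial1 v \<xi> \<tau>)
          + e * (partial2 r \<xi> \<tau> * v \<xi> \<tau> + r \<xi> \<tau> * partial2 v \<xi> \<tau>)
          + (partial1 r \<xi> \<tau> * (v \<xi> \<tau>)\<^sup>2 + 2 * r \<xi> \<tau> * v \<xi> \<tau> * partial1 v \<xi> \<tau>)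
          + partial1 p \<xi> \<tau> - e * partial1 (partial1 v) \<xi> \<tau>)"

lemma momentum_residual_gm_pull:
  assumes "open \<Omega>" and r: "differentiable_on2 r \<Omega>" and v: "differentiable_on2 v \<Omega>"
    and v1: "differentiable_on2 (partial1 v) \<Omega>" and pr: "differentiable_on2 pr \<Omega>"
    and p: "(x, t) \<in> gm_preimage a e \<Omega>"
  shows "momentum_residual (gm_pull a e r) (gm_pull a e v) (gm_pull a e pr) x t
    = gm_pull a e (gm_momentum a e r v pr) x t"
proof -
  have q: "(e * (x - a * t), e\<^sup>2 * t) \<in> \<Omega>"
    using p by (simp add: gm_preimage_def)
  note vv = differentiable_on2_mult[OF v v]
  note rvv = differentiable_on2_mult[OF r vv]
  \<comment> \<open>The square of the velocity becomes a product, so that the product rule applies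
    twice.\<close>
  have flux: "(\<lambda>x t. gm_pull a e r x t * (gm_pull a e v x t)\<^sup>2 + gm_pull a e pr x t)
      = gm_pull a e (\<lambda>\<xi> \<tau>. r \<xi> \<tau> * (v \<xi> \<tau> * v \<xi> \<tau>) + pr \<xi> \<tau>)"
    by (simp add: gm_pull_def [abs_def] power2_eq_square)
  \<comment> \<open>The inner derivative is a pullback at every point of the open preimage of
    \<open>\<Omega>\<close>, so it may be replaced before the outer derivative is taken.\<close>
  have "partial1 (partial1 (gm_pull a e v)) x t
      = partial1 (gm_pull a e (\<lambda>\<xi> \<tau>. e * partial1 v \<xi> \<tau>)) x t"
    by (rule partial_cong(1)[OF open_gm_preimage[OF \<open>open \<Omega>\<close>] p]) (rule partial_gm_pull(1)[OF v])
  also have "\<dots> = e * (e * partial1 (partial1 v) (e * (x - a * t)) (e\<^sup>2 * t))"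
    unfolding partial_gm_pull(1)[OF differentiable_on2_mult[OF differentiable_on2_const v1] p]
    by (simp add: gm_pull_def partial_cmult[OF v1 q])
  finally have viscous: "partial1 (partial1 (gm_pull a e v)) x t
      = e * (e * partial1 (partial1 v) (e * (x - a * t)) (e\<^sup>2 * t))" .
  show ?thesis
    unfolding momentum_residual_def viscous flux gm_pull_mult
      partial_gm_pull[OF differentiable_on2_mult[OF r v] p]
      partial_gm_pull[OF differentiable_on2_add[OF rvv pr] p]
    unfolding gm_pull_def gm_momentum_def partial_add[OF rvv pr q] partial_mult[OF r vv q] partial_mult[OF v v q]
      partial_mult[OF r v q]
    by (simp add: algebra_simps power2_eq_square)
qed

definition gm_material ::
  "real \<Rightarrow> real \<Rightarrow> (real \<Rightarrow> real \<Rightarrow> real) \<Rightarrow> (real \<Rightarrow> real \<Rightarrow> real) \<Rightarrow> real \<Rightarrow> real \<Rightarrow> real" where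
  "gm_material a e v f \<xi> \<tau> = e * ((- a + v \<xi> \<tau>) * partial1 f \<xi> \<tau> + e * partial2 f \<xi> \<tau>)"

lemma material_deriv_gm_pull:
  assumes "differentiable_on2 f \<Omega>" "(x, t) \<in> gm_preimage a e \<Omega>"
  shows "material_deriv (gm_pull a e v) (gm_pull a e f) x t = gm_pull a e (gm_material a e v f) x t"
  unfolding material_deriv_def partial_gm_pull[OF assms]
  by (simp add: gm_material_def gm_pull_def algebra_simps power2_eq_square)

lemma differentiable_on2_gm_material:
  assumes "twice_differentiable_on2 f \<Omega>" "differentiable_on2 v \<Omega>"
  shows "differentiable_on2 (gm_material a e v f) \<Omega>"
  using assms unfolding gm_material_def [abs_def] twice_differentiable_on2_iff
  by (intro differentiable_on2_intros) auto

lemma partial_gm_material: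
  assumes f: "twice_differentiable_on2 f \<Omega>" and v: "differentiable_on2 v \<Omega>" and p: "(\<xi>, \<tau>) \<in> \<Omega>"
  shows "partial1 (gm_material a e v f) \<xi> \<tau> =
           e * (partial1 v \<xi> \<tau> * partial1 f \<xi> \<tau> + (- a + v \<xi> \<tau>) * partial1 (partial1 f) \<xi> \<tau>
                + e * partial1 (partial2 f) \<xi> \<tau>)"
    and "partial2 (gm_material a e v f) \<xi> \<tau> =
           e * (partial2 v \<xi> \<tau> * partial1 f \<xi> \<tau> + (- a + v \<xi> \<tau>) * partial2 (partial1 f) \<xi> \<tau>
                + e * partial2 (partial2 f) \<xi> \<tau>)"
proof -
  have f: "differentiable_on2 (partial1 f) \<Omega>" "differentiable_on2 (partial2 f) \<Omega>"
    using f by (auto simp: twice_differentiable_on2_iff)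
  note c = differentiable_on2_const
  note av = differentiable_on2_add[OF c v]
  note s1 = differentiable_on2_mult[OF av f(1)] and s2 = differentiable_on2_mult[OF c f(2)]
  note rules = partial_cmult[OF differentiable_on2_add[OF s1 s2] p] partial_add[OF s1 s2 p]
    partial_mult[OF av f(1) p] partial_add[OF c v p] partial_cmult[OF f(2) p] partial_const
  show "partial1 (gm_material a e v f) \<xi> \<tau> =
           e * (partial1 v \<xi> \<tau> * partial1 f \<xi> \<tau> + (- a + v \<xi> \<tau>) * partial1 (partial1 f) \<xi> \<tau>
                + e * partial1 (partial2 f) \<xi> \<tau>)"
    unfolding gm_material_def [abs_def] rules by simp
  show "partial2 (gm_material a e v f) \<xi> \<tau> =
           e * (partial2 v \<xi> \<tau> * partial1 f \<xi> \<tau> + (- a + v \<xi> \<tau>) * partial2 (partial1 f) \<xi> \<tau>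
                + e * partial2 (partial2 f) \<xi> \<tau>)"
    unfolding gm_material_def [abs_def] rules by simp
qed

lemma material_deriv_twice_gm_pull:
  assumes "open \<Omega>" and f: "twice_differentiable_on2 f \<Omega>" and v: "differentiable_on2 v \<Omega>"
    and p: "(x, t) \<in> gm_preimage a e \<Omega>"
  shows "material_deriv (gm_pull a e v) (material_deriv (gm_pull a e v) (gm_pull a e f)) x t
    = gm_pull a e (gm_material a e v (gm_material a e v f)) x t"
proof -
  have f1: "differentiable_on2 f \<Omega>"
    using f by (simp add: twice_differentiable_on2_iff)
  have "material_deriv (gm_pull a e v) (material_deriv (gm_pull a e v) (gm_pull a e f)) x t
    = material_deriv (gm_pull a e v) (gm_pull a e (gm_material a e v f)) x t"
    \<comment> \<open>Only the outer material derivative is opened on either side; the inner ones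
      agree on an open set, so their values and both partial derivatives agree.\<close>
    unfolding material_deriv_def[of _ "material_deriv _ _"] material_deriv_def[of _ "gm_pull _ _ (gm_material _ _ _ _)"]
    using partial_cong[OF open_gm_preimage[OF \<open>open \<Omega>\<close>] p material_deriv_gm_pull[OF f1]] by simp
  also have "\<dots> = gm_pull a e (gm_material a e v (gm_material a e v f)) x t"
    by (rule material_deriv_gm_pull[OF differentiable_on2_gm_material[OF f v] p])
  finally show ?thesis .
qed

definition gm_pressure ::
  "real \<Rightarrow> real \<Rightarrow> (real \<Rightarrow> real \<Rightarrow> real) \<Rightarrow> (real \<Rightarrow> real \<Rightarrow> real) \<Rightarrow> (real \<Rightarrow> real \<Rightarrow> real)
    \<Rightarrow> (real \<Rightarrow> real \<Rightarrow> real) \<Rightarrow> real \<Rightarrow> real \<Rightarrow> real" where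
  "gm_pressure a e v p g b \<xi> \<tau> =
     p \<xi> \<tau> - (g \<xi> \<tau> - (b \<xi> \<tau> * gm_material a e v (gm_material a e v b) \<xi> \<tau>
                        + 3/2 * (gm_material a e v b \<xi> \<tau>)\<^sup>2
                        + 4/3 * (gm_material a e v b \<xi> \<tau> / b \<xi> \<tau>)))"

lemma pressure_residual_gm_pull:
  assumes "open \<Omega>" and b: "twice_differentiable_on2 b \<Omega>" and v: "differentiable_on2 v \<Omega>"
    and p: "(x, t) \<in> gm_preimage a e \<Omega>"
  shows "pressure_residual (gm_pull a e v) (gm_pull a e pr) (gm_pull a e g) (gm_pull a e b) x t
    = gm_pull a e (gm_pressure a e v pr g b) x t"
proof -
  have "differentiable_on2 b \<Omega>"
    using b by (simp add: twice_differentiable_on2_iff)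
  from material_deriv_gm_pull[OF this p] show ?thesis
    unfolding pressure_residual_def material_deriv_twice_gm_pull[OF assms]
    by (simp add: gm_pull_def gm_pressure_def)
qed

definition gm_gas ::
  "real \<Rightarrow> real \<Rightarrow> real \<Rightarrow> real \<Rightarrow> real \<Rightarrow> real \<Rightarrow> (real \<Rightarrow> real \<Rightarrow> real) \<Rightarrow> (real \<Rightarrow> real \<Rightarrow> real)
    \<Rightarrow> (real \<Rightarrow> real \<Rightarrow> real) \<Rightarrow> real \<Rightarrow> real \<Rightarrow> real" where
  "gm_gas \<gamma> P0 T0 R0 a e v g b \<xi> \<tau> =
     gm_material a e v g \<xi> \<tau>
     + 3 * \<gamma> * g \<xi> \<tau> * (gm_material a e v b \<xi> \<tau> / b \<xi> \<tau>)
     + 3 * (\<gamma> - 1) * (T0 / b \<xi> \<tau>) * ((g \<xi> \<tau> / P0) * ((b \<xi> \<tau>) ^ 3 / R0 ^ 3) - 1)"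

lemma gas_residual_gm_pull:
  assumes "differentiable_on2 g \<Omega>" "differentiable_on2 b \<Omega>" "(x, t) \<in> gm_preimage a e \<Omega>"
  shows "gas_residual \<gamma> P0 T0 R0 (gm_pull a e v) (gm_pull a e g) (gm_pull a e b) x t
    = gm_pull a e (gm_gas \<gamma> P0 T0 R0 a e v g b) x t"
  unfolding gas_residual_def material_deriv_gm_pull[OF assms(1,3)] material_deriv_gm_pull[OF assms(2,3)]
  by (simp add: gm_pull_def gm_gas_def)

section \<open>Returning from \<open>e\<close> to powers of \<open>\<epsilon>\<close>\<close>

lemma at_gm_gm_pull:
  assumes "0 < \<epsilon>" "(\<xi>, \<tau>) \<in> \<Omega>"
    and E: "\<And>x t. (x, t) \<in> gm_preimage a (\<epsilon> powr \<alpha>) \<Omega> \<Longrightarrow> E \<epsilon> x t = gm_pull a (\<epsilon> powr \<alpha>) f x t"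
  shows "at_gm \<alpha> \<alpha> a E \<xi> \<tau> \<epsilon> = f \<xi> \<tau>"
proof -
  define e where "e = \<epsilon> powr \<alpha>"
  \<comment> \<open>These \<open>x\<close> and \<open>t\<close> invert the substitution. Evaluating
    a pullback at them removes all dependence on the moving point and leaves the transported
    expression at the fixed \<open>(\<xi>, \<tau>)\<close>.\<close>
  define t where "t = \<tau> / e\<^sup>2"
  define x where "x = \<xi> / e + a * t"
  have "\<epsilon> powr (\<alpha> + \<alpha>) = e\<^sup>2"
    by (simp only: e_def powr_add power2_eq_square)
  then have "at_gm \<alpha> \<alpha> a E \<xi> \<tau> \<epsilon> = E \<epsilon> x t"
    by (simp add: at_gm_def x_def t_def e_def)
  moreover have "e \<noteq> 0"
    using assms(1) by (simp add: e_def)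
  then have "e * (x - a * t) = \<xi>" "e\<^sup>2 * t = \<tau>"
    by (simp_all add: x_def t_def)
  ultimately show ?thesis
    using assms(2) E[of x t] by (simp add: gm_preimage_def gm_pull_def flip: e_def)
qed

lemma gm_expansion_eq_gm_pull:
  assumes "0 < \<epsilon>"
  shows "gm_expansion \<alpha> \<alpha> \<alpha> \<alpha> a N c f \<epsilon> = gm_pull a (\<epsilon> powr \<alpha>) (eps_sum N c (\<epsilon> powr \<alpha>) f)"
proof (intro ext)
  fix x t
  \<comment> \<open>With \<open>q = k = \<alpha>\<close> the exponent \<open>q + (n - 1) * k\<close>
    is \<open>n * \<alpha>\<close>, which makes the generalized power series an ordinary one in
    \<open>e\<close>.\<close>
  have "\<epsilon> powr (\<alpha> + (real n - 1) * \<alpha>) = (\<epsilon> powr \<alpha>) ^ n" for n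
    using assms by (simp add: powr_power algebra_simps)
  moreover have "\<epsilon> powr (\<alpha> + \<alpha>) = (\<epsilon> powr \<alpha>)\<^sup>2"
    by (simp only: powr_add power2_eq_square)
  ultimately show "gm_expansion \<alpha> \<alpha> \<alpha> \<alpha> a N c f \<epsilon> x t
      = gm_pull a (\<epsilon> powr \<alpha>) (eps_sum N c (\<epsilon> powr \<alpha>) f) x t"
    unfolding gm_expansion_def gm_pull_def eps_sum_def by (simp only:)
qed

text \<open>Since \<open>\<alpha> > 0\<close>, the map from \<open>\<epsilon>\<close> to
  \<open>\<epsilon> powr \<alpha>\<close> tends to 0 from the right, so the bound in
  \<open>e\<close> can be composed with it; \<open>e ^ m\<close> then has exactly the order
  \<open>p + 2 * k\<close> of the tolerated remainder.\<close>

lemma lowest_terms_powrI: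
  assumes "0 < \<alpha>" "g \<in> O[at_right 0](\<lambda>e. e ^ m)" "p + 2 * k = real m * \<alpha>"
    and "\<And>\<epsilon>. 0 < \<epsilon> \<Longrightarrow> f \<epsilon> = g (\<epsilon> powr \<alpha>)"
  shows "lowest_terms p k f 0 0"
proof -
  have "filterlim (\<lambda>\<epsilon>. \<epsilon> powr \<alpha>) (at_right 0) (at_right 0)"
    using \<open>0 < \<alpha>\<close> by real_asymp
  from landau_o.big.compose[OF assms(2) this]
  have "(\<lambda>\<epsilon>. g (\<epsilon> powr \<alpha>)) \<in> O[at_right 0](\<lambda>\<epsilon>. (\<epsilon> powr \<alpha>) ^ m)" .
  moreover have "\<forall>\<^sub>F \<epsilon> in at_right 0. g (\<epsilon> powr \<alpha>) = f \<epsilon>"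
    using assms(4) by (auto intro: eventually_mono[OF eventually_at_right_less])
  moreover have "\<forall>\<^sub>F \<epsilon> in at_right 0. (\<epsilon> powr \<alpha>) ^ m = \<epsilon> powr (p + 2 * k)"
    unfolding assms(3)
    by (rule eventually_mono[OF eventually_at_right_less]) (simp add: powr_power mult.commute)
  ultimately have "f \<in> O[at_right 0](\<lambda>\<epsilon>. \<epsilon> powr (p + 2 * k))"
    by (simp add: landau_o.big.in_cong landau_o.big.cong)
  then show ?thesis
    unfolding lowest_terms_def by simp
qed

lemma lowest_terms_gm_pull:
  assumes "0 < \<alpha>" "(\<xi>, \<tau>) \<in> \<Omega>"
    and "\<And>\<epsilon> x t. 0 < \<epsilon> \<Longrightarrow> (x, t) \<in> gm_preimage a (\<epsilon> powr \<alpha>) \<Omega> \<Longrightarrow>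
           E \<epsilon> x t = gm_pull a (\<epsilon> powr \<alpha>) (F (\<epsilon> powr \<alpha>)) x t"
    and "(\<lambda>e. F e \<xi> \<tau>) \<in> O[at_right 0](\<lambda>e. e ^ m)" "p + 2 * k = real m * \<alpha>"
  shows "lowest_terms p k (at_gm \<alpha> \<alpha> a E \<xi> \<tau>) 0 0"
  by (rule lowest_terms_powrI[OF assms(1,4,5)]) (rule at_gm_gm_pull[OF _ assms(2) assms(3)])

section \<open>Cancellation of the two lowest orders\<close>

text \<open>The last two hypotheses say precisely that the coefficients of \<open>e\<close> and
  \<open>e ^ 2\<close> in the bracket vanish; its constant coefficient is 0 already.\<close>

lemma mass_jet:
  assumes "jet r r0 r1 r2" "jet rx 0 rx1 rx2" "jet rt 0 rt1 rt2" "jet v 0 v1 v2" "jet vx 0 vx1 vx2"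
    and "r0 * vx1 = a * rx1" "r0 * vx2 = a * rx2 - (rt1 + rx1 * v1 + r1 * vx1)"
  shows "(\<lambda>e. e * (- a * rx e + e * rt e + (rx e * v e + r e * vx e))) \<in> O[at_right 0](\<lambda>e. e ^ 4)"
  by (rule ident_mult_bigo, rule jet_bigo, rule jet_cong, (rule assms(1-5) jet_intros)+)
     (use assms(6-7) in simp_all)

text \<open>As for mass, the last two hypotheses are the two coefficient balances of the bracket.
  The terms \<open>e * rt * v\<close> and \<open>rx * v ^ 2\<close> are of third order and leave no
  trace in them.\<close>

lemma momentum_jet:
  assumes "jet r r0 r1 r2" "jet rx 0 rx1 rx2" "jet rt 0 rt1 rt2" "jet v 0 v1 v2" "jet vx 0 vx1 vx2"
    "jet vt 0 vt1 vt2" "jet vxx 0 vxx1 vxx2" "jet px 0 px1 px2"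
    and "px1 = a * r0 * vx1"
      "px2 = a * (r0 * vx2 + rx1 * v1 + r1 * vx1) - r0 * vt1 - 2 * r0 * v1 * vx1 + vxx1"
  shows "(\<lambda>e. e * (- a * (rx e * v e + r e * vx e) + e * (rt e * v e + r e * vt e)
                + (rx e * (v e)\<^sup>2 + 2 * r e * v e * vx e) + px e - e * vxx e))
          \<in> O[at_right 0](\<lambda>e. e ^ 4)"
  by (rule ident_mult_bigo, rule jet_bigo, rule jet_cong, (rule assms(1-8) jet_intros)+)
     (use assms(9-10) in \<open>simp_all add: algebra_simps\<close>)

text \<open>Each material derivative contributes a factor \<open>e\<close>, and derivatives of the
  bubble radius start at order 1. The second material derivative is thus of order 3 and the squared
  first one of order 4; only the quotient with factor 4/3 reaches order 2, where it gives
  \<open>- 4 * a / (3 * b0) * bx1\<close>.\<close>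

lemma pressure_jet:
  assumes jets: "jet b b0 b1 b2" "jet bx 0 bx1 bx2" "jet bt 0 bt1 bt2" "jet bxx 0 bxx1 bxx2"
    "jet bxt 0 bxt1 bxt2" "jet btx 0 btx1 btx2" "jet btt 0 btt1 btt2"
    "jet v 0 v1 v2" "jet vx 0 vx1 vx2" "jet vt 0 vt1 vt2" "jet p p0 p1 p2" "jet g p0 p1 g2"
    and "b0 \<noteq> 0" "p2 = g2 + 4 * a / (3 * b0) * bx1"
  shows "(\<lambda>e. p e - (g e - (b e * (e * ((- a + v e) * (e * (vx e * bx e + (- a + v e) * bxx e + e * bxt e))
                                     + e * (e * (vt e * bx e + (- a + v e) * btx e + e * btt e))))
                + 3/2 * (e * ((- a + v e) * bx e + e * bt e))\<^sup>2
                + 4/3 * (e * ((- a + v e) * bx e + e * bt e) / b e)))) \<in> O[at_right 0](\<lambda>e. e ^ 3)"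
  by (rule jet_bigo, rule jet_cong, (rule jets jet_intros \<open>b0 \<noteq> 0\<close>)+)
     (use assms(13-14) in \<open>simp_all add: field_simps\<close>)

text \<open>The relation for \<open>g1\<close> removes the first-order part of the thermal factor,
  and the relation for \<open>g2\<close> makes its second-order part
  \<open>a * p0 / T0 * bx1\<close>. At order 2 the transport, compression and thermal terms
  contribute \<open>a * p0 * bx1 / b0\<close> times 3, \<open>- 3 * \<gamma>\<close> and
  \<open>3 * (\<gamma> - 1)\<close>, which sum to zero.\<close>

lemma gas_jet:
  assumes jets: "jet b b0 b1 b2" "jet bx 0 bx1 bx2" "jet bt 0 bt1 bt2"
    "jet v 0 v1 v2" "jet g p0 g1 g2" "jet gx 0 gx1 gx2" "jet gt 0 gt1 gt2"
    and nz: "b0 \<noteq> 0" "p0 \<noteq> 0" "T0 \<noteq> 0"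
    and "g1 = - (3 * p0 / b0) * b1" "gx1 = - (3 * p0 / b0) * bx1"
      "g2 = - (3 * p0 / b0) * b2 + a * p0\<^sup>2 / T0 * bx1 + 6 * p0 / b0\<^sup>2 * b1\<^sup>2"
  shows "(\<lambda>e. e * ((- a + v e) * gx e + e * gt e)
                + 3 * \<gamma> * g e * (e * ((- a + v e) * bx e + e * bt e) / b e)
                + 3 * (\<gamma> - 1) * (T0 / b e) * ((g e / p0) * (b e ^ 3 / b0 ^ 3) - 1))
          \<in> O[at_right 0](\<lambda>e. e ^ 3)"
proof -
  have p: "jet (\<lambda>e. g e / p0) 1 (- 3 * b1 / b0) (g2 / p0)"
    using jet_mult[OF jets(5) jet_const[of "1 / p0"]] nz assms(11)
    by (simp add: field_simps)
  have b: "jet (\<lambda>e. b e ^ 3 / b0 ^ 3) 1 (3 * b1 / b0) (3 * b2 / b0 + 3 * b1\<^sup>2 / b0\<^sup>2)"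
    unfolding divide_inverse[of "b _ ^ 3"]
    by (rule jet_cong[OF jet_mult[OF jet_power3[OF jets(1)] jet_const]])
       (use nz in \<open>simp_all add: field_simps power2_eq_square power3_eq_cube\<close>)
  have "(g2 / p0 + 3 * b2 / b0 + 3 * b1\<^sup>2 / b0\<^sup>2 - 9 * b1\<^sup>2 / b0\<^sup>2) = a * p0 / T0 * bx1"
    unfolding assms(13) using nz by (simp add: field_simps power2_eq_square)
  then have pb: "jet (\<lambda>e. (g e / p0) * (b e ^ 3 / b0 ^ 3) - 1) 0 0 (a * p0 / T0 * bx1)"
    using jet_diff[OF jet_mult[OF p b] jet_const[of 1]]
    by (simp add: algebra_simps power2_eq_square)
  show ?thesis
    by (rule jet_bigo, rule jet_cong, (rule pb jets jet_intros nz)+)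
       (use nz assms(12) in \<open>simp_all add: field_simps power2_eq_square\<close>)
qed

lemma density_jet:
  assumes jets: "jet r (1 / D) r1 r2" "jet b b0 b1 b2"
    and D: "D = b0 ^ 3 - X + 1" "D \<noteq> 0" "b0 \<noteq> 0"
    and "b1 = - (D\<^sup>2 / (3 * b0\<^sup>2)) * r1"
      "b2 = - (D\<^sup>2 / (3 * b0\<^sup>2)) * r2 + (2 * b0 ^ 3 + X - 1) * D ^ 3 / (9 * b0 ^ 5) * r1\<^sup>2"
  shows "(\<lambda>e. (1 - X + b e ^ 3) * r e - 1) \<in> O[at_right 0](\<lambda>e. e ^ 3)"
proof -
  \<comment> \<open>Eliminating \<open>X\<close> turns the coefficient equations into rational
    identities in \<open>b0\<close> and \<open>D\<close>.\<close>
  have X: "X = b0 ^ 3 + 1 - D" using D by simp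
  show ?thesis
    apply (rule jet_bigo, rule jet_cong, (rule jets jet_intros)+)
    unfolding assms(6,7) X
    using D(2,3) by (simp_all add: field_simps eval_nat_numeral)
qed

text \<open>Fractional powers occur only in \<open>a0\<close> and \<open>B\<close>. The momentum
  balance is compared after multiplication by \<open>a0\<close>, where they appear as
  \<open>a0 ^ 2\<close> and \<open>a0 * B\<close>; both are rational in \<open>P0\<close>,
  \<open>R0\<close> and \<open>D\<close>.\<close>

lemma wave_speed_powr:
  fixes P0 R0 D :: real
  assumes "0 < P0" "0 < R0" and a: "a = R0 powr (-3/2) * P0 powr (1/2) * D"
  shows "a\<^sup>2 = P0 * D\<^sup>2 / R0 ^ 3"
    and "a * - (P0 powr (1/2) * D ^ 3 / R0 powr (9/2)) = - (P0 * D ^ 4 / R0 ^ 6)"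
proof -
  have P: "P0 powr (1/2) * P0 powr (1/2) = P0"
    using assms by (simp flip: powr_add)
  have "R0 powr (-3/2) * R0 powr (-3/2) = R0 powr (- 3)"
    by (simp flip: powr_add)
  also have "\<dots> = 1 / R0 ^ 3"
    using assms by (simp add: powr_minus_divide)
  finally have R: "R0 powr (-3/2) * R0 powr (-3/2) = 1 / R0 ^ 3" .
  have "R0 powr (-3/2) / R0 powr (9/2) = R0 powr (- 6)"
    by (simp flip: powr_diff)
  also have "\<dots> = 1 / R0 ^ 6"
    using assms by (simp add: powr_minus_divide)
  finally have R': "R0 powr (-3/2) / R0 powr (9/2) = 1 / R0 ^ 6" .
  have "a\<^sup>2 = (R0 powr (-3/2) * R0 powr (-3/2)) * (P0 powr (1/2) * P0 powr (1/2)) * D\<^sup>2"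
    unfolding a by (simp only: power2_eq_square mult_ac)
  then show "a\<^sup>2 = P0 * D\<^sup>2 / R0 ^ 3"
    unfolding P R by simp
  have "a * - (P0 powr (1/2) * D ^ 3 / R0 powr (9/2))
      = - ((P0 powr (1/2) * P0 powr (1/2)) * D ^ 4 * (R0 powr (-3/2) / R0 powr (9/2)))"
    unfolding a by (simp add: eval_nat_numeral)
  then show "a * - (P0 powr (1/2) * D ^ 3 / R0 powr (9/2)) = - (P0 * D ^ 4 / R0 ^ 6)"
    unfolding P R' by simp
qed

text \<open>These are the coefficients of \<open>\<rho> 2\<close>, of the
  \<open>\<xi>\<close>-derivative of \<open>\<rho> 1\<close> and of the square of
  \<open>\<rho> 1\<close> in \<open>P 2\<close>. Since \<open>1 - X = D - R0 ^ 3\<close>, the 13/3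
  in \<open>A\<close> splits as 3 + 4/3 and the bracket becomes
  \<open>3 * R0 ^ 3 * T0 + (P0 ^ 2 * R0 + 4/3 * T0) * D\<close>: the first summand accounts for the
  viscosity \<open>u_xx\<close>, the second for the damping and thermal terms. In the third identity
  \<open>2 * R0 ^ 3 + X - 1 = 3 * R0 ^ 3 - D\<close> separates \<open>a ^ 2 * D\<close> from
  \<open>a * B\<close>.\<close>

lemma momentum_coefficients:
  fixes P0 T0 R0 X D a A B :: real
  assumes nz: "T0 \<noteq> 0" "R0 \<noteq> 0" "D \<noteq> 0" and X: "X = R0 ^ 3 + 1 - D"
    and a: "a\<^sup>2 = P0 * D\<^sup>2 / R0 ^ 3" and aB: "a * B = - (P0 * D ^ 4 / R0 ^ 6)"
    and A: "A = ((P0\<^sup>2 * R0 ^ 4 + 13/3 * R0 ^ 3 * T0 + (P0\<^sup>2 * R0 + 4/3 * T0) * (1 - X)) * D)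
                  / (6 * R0 ^ 3 * T0)"
    and C: "C = - (D\<^sup>2 / (3 * R0\<^sup>2))"
  shows "- (3 * P0 / R0) * C = a\<^sup>2"
    and "(4 * a / (3 * R0) + a * P0\<^sup>2 / T0) * C = a * D - 2 * (a * A)"
    and "- (3 * P0 / R0) * ((2 * R0 ^ 3 + X - 1) * D ^ 3 / (9 * R0 ^ 5)) + 6 * P0 / R0\<^sup>2 * C\<^sup>2
           = - (a * B + a\<^sup>2 * D)"
proof -
  show "- (3 * P0 / R0) * C = a\<^sup>2"
    unfolding a C using nz by (simp add: field_simps eval_nat_numeral)
  show "(4 * a / (3 * R0) + a * P0\<^sup>2 / T0) * C = a * D - 2 * (a * A)"
    unfolding A X C using nz by (simp add: field_simps eval_nat_numeral)
  show "- (3 * P0 / R0) * ((2 * R0 ^ 3 + X - 1) * D ^ 3 / (9 * R0 ^ 5)) + 6 * P0 / R0\<^sup>2 * C\<^sup>2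
           = - (a * B + a\<^sup>2 * D)"
    unfolding a aB X C using nz by (simp add: field_simps eval_nat_numeral)
qed

theorem proposition3p1:
  fixes X \<gamma> P0 T0 R0 \<alpha> \<beta> q k a0 \<rho>0 A B :: real
    and \<rho> u P P2 R :: "nat \<Rightarrow> real \<Rightarrow> real \<Rightarrow> real"
    and \<rho>E uE PE P2E RE :: "real \<Rightarrow> real \<Rightarrow> real \<Rightarrow> real"
    and \<Omega> :: "(real \<times> real) set"
    and N :: nat
  assumes params: "0 < P0" "0 < T0" "0 < R0" "0 \<le> X" "X \<le> 1"
    and exponents: "0 < \<alpha>" "\<alpha> = \<beta>" "\<beta> = q" "q = k"
    and rho0: "\<rho>0 = 1 / (R0 ^ 3 - X + 1)"
    and a0: "a0 = R0 powr (-3/2) * P0 powr (1/2) * (R0 ^ 3 - X + 1)"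
    and A: "A = ((P0\<^sup>2 * R0 ^ 4 + 13/3 * R0 ^ 3 * T0 + (P0\<^sup>2 * R0 + 4/3 * T0) * (1 - X))
                  * (R0 ^ 3 - X + 1)) / (6 * R0 ^ 3 * T0)"
    and B: "B = - (P0 powr (1/2) * (R0 ^ 3 - X + 1) ^ 3 / R0 powr (9/2))"
    and domain: "open \<Omega>"
    and N: "2 \<le> N"
    and regular: "\<And>f n. f \<in> {\<rho>, u, P, P2, R} \<Longrightarrow> n \<in> {1..N} \<Longrightarrow> twice_differentiable_on2 (f n) \<Omega>"
    and burgers: "\<And>\<xi> \<tau>. (\<xi>, \<tau>) \<in> \<Omega> \<Longrightarrow>
      partial2 (\<rho> 1) \<xi> \<tau> = A * partial1 (partial1 (\<rho> 1)) \<xi> \<tau> + B * \<rho> 1 \<xi> \<tau> * partial1 (\<rho> 1) \<xi> \<tau>"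
    and first_order: "\<And>\<xi> \<tau>. (\<xi>, \<tau>) \<in> \<Omega> \<Longrightarrow>
      partial1 (u 1) \<xi> \<tau> = a0 / \<rho>0 * partial1 (\<rho> 1) \<xi> \<tau> \<and>
      P 1 \<xi> \<tau> = P2 1 \<xi> \<tau> \<and>
      P2 1 \<xi> \<tau> = - (3 * P0 / R0) * R 1 \<xi> \<tau> \<and>
      R 1 \<xi> \<tau> = - ((R0 ^ 3 - X + 1)\<^sup>2 / (3 * R0\<^sup>2)) * \<rho> 1 \<xi> \<tau> \<and>
      partial1 (P 1) \<xi> \<tau> = \<rho>0 * a0 * partial1 (u 1) \<xi> \<tau>"
    \<comment> \<open>the function of \<open>\<tau>\<close> left free by the relation for the derivative of \<open>u 1\<close> is zero\<close>
    and no_integration_constant: "\<And>\<xi> \<tau>. (\<xi>, \<tau>) \<in> \<Omega> \<Longrightarrow> u 1 \<xi> \<tau> = a0 / \<rho>0 * \<rho> 1 \<xi> \<tau>"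
    and second_order: "\<And>\<xi> \<tau>. (\<xi>, \<tau>) \<in> \<Omega> \<Longrightarrow>
      partial1 (u 2) \<xi> \<tau> = a0 / \<rho>0 * partial1 (\<rho> 2) \<xi> \<tau>
        - 1 / \<rho>0 * (partial2 (\<rho> 1) \<xi> \<tau> + 2 * a0 / \<rho>0 * \<rho> 1 \<xi> \<tau> * partial1 (\<rho> 1) \<xi> \<tau>) \<and>
      P 2 \<xi> \<tau> = P2 2 \<xi> \<tau> + 4 * a0 / (3 * R0) * partial1 (R 1) \<xi> \<tau> \<and>
      P2 2 \<xi> \<tau> = - (3 * P0 / R0) * R 2 \<xi> \<tau> + a0 * P0\<^sup>2 / T0 * partial1 (R 1) \<xi> \<tau>
        + 6 * P0 / R0\<^sup>2 * (R 1 \<xi> \<tau>)\<^sup>2 \<and>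
      R 2 \<xi> \<tau> = - ((R0 ^ 3 - X + 1)\<^sup>2 / (3 * R0\<^sup>2)) * \<rho> 2 \<xi> \<tau>
        + (2 * R0 ^ 3 + X - 1) * (R0 ^ 3 - X + 1) ^ 3 / (9 * R0 ^ 5) * (\<rho> 1 \<xi> \<tau>)\<^sup>2"
    and expansions:
      "\<rho>E = gm_expansion \<alpha> \<beta> q k a0 N \<rho>0 \<rho>"
      "uE = gm_expansion \<alpha> \<beta> q k a0 N 0 u"
      "PE = gm_expansion \<alpha> \<beta> q k a0 N P0 P"
      "P2E = gm_expansion \<alpha> \<beta> q k a0 N P0 P2"
      "RE = gm_expansion \<alpha> \<beta> q k a0 N R0 R"
  shows "\<forall>(\<xi>, \<tau>)\<in>\<Omega>.
    lowest_terms (q + \<alpha>) k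
      (at_gm \<alpha> \<beta> a0 (\<lambda>\<epsilon>. mass_residual (\<rho>E \<epsilon>) (uE \<epsilon>)) \<xi> \<tau>) 0 0 \<and>
    lowest_terms (q + \<alpha>) k
      (at_gm \<alpha> \<beta> a0 (\<lambda>\<epsilon>. momentum_residual (\<rho>E \<epsilon>) (uE \<epsilon>) (PE \<epsilon>)) \<xi> \<tau>) 0 0 \<and>
    lowest_terms q k
      (at_gm \<alpha> \<beta> a0 (\<lambda>\<epsilon>. pressure_residual (uE \<epsilon>) (PE \<epsilon>) (P2E \<epsilon>) (RE \<epsilon>)) \<xi> \<tau>) 0 0 \<and>
    lowest_terms q k
      (at_gm \<alpha> \<beta> a0 (\<lambda>\<epsilon>. gas_residual \<gamma> P0 T0 R0 (uE \<epsilon>) (P2E \<epsilon>) (RE \<epsilon>)) \<xi> \<tau>) 0 0 \<and>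
    lowest_terms q k
      (at_gm \<alpha> \<beta> a0 (\<lambda>\<epsilon>. density_residual X (\<rho>E \<epsilon>) (RE \<epsilon>)) \<xi> \<tau>) 0 0"
proof (intro ballI, clarify)
  fix \<xi> \<tau> assume p: "(\<xi>, \<tau>) \<in> \<Omega>"
  define D where "D = R0 ^ 3 - X + 1"
  \<comment> \<open>Here \<open>X \<le> 1\<close> enters; \<open>D\<close> is the reciprocal of the
    equilibrium density and occurs in denominators below.\<close>
  have D: "0 < D"
  proof -
    have "0 < R0 ^ 3" using params by simp
    then show ?thesis using params unfolding D_def by linarith
  qed
  have X: "X = R0 ^ 3 + 1 - D"
    by (simp add: D_def)
  have \<rho>0: "\<rho>0 = 1 / D"
    using rho0 by (simp add: D_def)
  have ratio: "a0 / \<rho>0 = a0 * D"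
    by (simp add: \<rho>0)
  have eqs: "\<beta> = \<alpha>" "q = \<alpha>" "k = \<alpha>"
    using exponents by auto
  define C where "C = - (D\<^sup>2 / (3 * R0\<^sup>2))"
  have a2: "a0\<^sup>2 = P0 * D\<^sup>2 / R0 ^ 3" and aB: "a0 * B = - (P0 * D ^ 4 / R0 ^ 6)"
    using wave_speed_powr[of P0 R0 a0 D] params a0 B by (simp_all add: D_def)
  note coefficients = momentum_coefficients[OF _ _ _ X a2 aB A[folded D_def] C_def]

  have diff: "differentiable_on2 (f n) \<Omega>" "differentiable_on2 (partial1 (f n)) \<Omega>"
    if "f \<in> {\<rho>, u, P, P2, R}" "n \<in> {1..N}" for f n
    using regular[OF that] by (simp_all add: twice_differentiable_on2_iff)
  have d1: "differentiable_on2 (\<rho> 1) \<Omega>" "differentiable_on2 (partial1 (\<rho> 1)) \<Omega>"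
    "differentiable_on2 (\<rho> 2) \<Omega>" "differentiable_on2 (R 1) \<Omega>"
    using diff N by auto

  \<comment> \<open>First- and second-order fields and their derivatives in terms of the
    densities\<close>
  have R1: "R 1 \<xi> \<tau> = C * \<rho> 1 \<xi> \<tau>" if "(\<xi>, \<tau>) \<in> \<Omega>" for \<xi> \<tau>
    using first_order[OF that] unfolding C_def D_def by blast
  have R1_x: "partial1 (R 1) \<xi> \<tau> = C * partial1 (\<rho> 1) \<xi> \<tau>" if "(\<xi>, \<tau>) \<in> \<Omega>" for \<xi> \<tau>
    using partial_cong(1)[OF domain that R1] partial_cmult(1)[OF d1(1) that] by simp
  \<comment> \<open>The second-order balances contain \<open>u 1\<close> itself and its
    \<open>\<tau>\<close>-derivative, which the formula for its \<open>\<xi>\<close>-derivative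
    fixes only up to a function of \<open>\<tau>\<close>.\<close>
  have u1: "u 1 \<xi> \<tau> = a0 * D * \<rho> 1 \<xi> \<tau>" if "(\<xi>, \<tau>) \<in> \<Omega>" for \<xi> \<tau>
    using no_integration_constant[OF that] unfolding ratio .
  have u1_x: "partial1 (u 1) \<xi> \<tau> = a0 * D * partial1 (\<rho> 1) \<xi> \<tau>" if "(\<xi>, \<tau>) \<in> \<Omega>" for \<xi> \<tau>
    using first_order[OF that] unfolding ratio by blast
  have u1_xx: "partial1 (partial1 (u 1)) \<xi> \<tau> = a0 * D * partial1 (partial1 (\<rho> 1)) \<xi> \<tau>"
    using partial_cong(1)[OF domain p u1_x] partial_cmult(1)[OF d1(2) p] by simp
  have u1_t: "partial2 (u 1) \<xi> \<tau> = a0 * D * partial2 (\<rho> 1) \<xi> \<tau>"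
    using partial_cong(2)[OF domain p u1] partial_cmult(2)[OF d1(1) p] by simp
  have P1: "P 1 \<xi> \<tau> = P2 1 \<xi> \<tau>" "P2 1 \<xi> \<tau> = - (3 * P0 / R0) * R 1 \<xi> \<tau>" if "(\<xi>, \<tau>) \<in> \<Omega>" for \<xi> \<tau>
    using first_order[OF that] by blast+
  have P1_x: "partial1 (P 1) \<xi> \<tau> = a0 * \<rho>0 * partial1 (u 1) \<xi> \<tau>"
    using first_order[OF p] by simp
  have P21_x: "partial1 (P2 1) \<xi> \<tau> = - (3 * P0 / R0) * partial1 (R 1) \<xi> \<tau>"
  proof -
    have "partial1 (P2 1) \<xi> \<tau> = partial1 (\<lambda>\<xi> \<tau>. - (3 * P0 / R0) * R 1 \<xi> \<tau>) \<xi> \<tau>"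
      by (rule partial_cong(1)[OF domain p P1(2)])
    also have "\<dots> = - (3 * P0 / R0) * partial1 (R 1) \<xi> \<tau>"
      by (rule partial_cmult(1)[OF d1(4) p])
    finally show ?thesis .
  qed
  \<comment> \<open>Multiplied by \<open>\<rho>0\<close>, the relation for \<open>u 2\<close> has
    the shape of the second-order mass balance.\<close>
  have u2_x: "\<rho>0 * partial1 (u 2) \<xi> \<tau> = a0 * partial1 (\<rho> 2) \<xi> \<tau>
      - (partial2 (\<rho> 1) \<xi> \<tau> + 2 * (a0 * D) * \<rho> 1 \<xi> \<tau> * partial1 (\<rho> 1) \<xi> \<tau>)"
    using second_order[OF p] D unfolding \<rho>0 by (simp add: field_simps)
  have P_2: "P 2 \<xi> \<tau> = P2 2 \<xi> \<tau> + 4 * a0 / (3 * R0) * partial1 (R 1) \<xi> \<tau>"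
    and P2_2: "P2 2 \<xi> \<tau> = - (3 * P0 / R0) * R 2 \<xi> \<tau> + a0 * P0\<^sup>2 / T0 * partial1 (R 1) \<xi> \<tau>
        + 6 * P0 / R0\<^sup>2 * (R 1 \<xi> \<tau>)\<^sup>2"
    and R_2: "R 2 \<xi> \<tau> = C * \<rho> 2 \<xi> \<tau>
        + (2 * R0 ^ 3 + X - 1) * D ^ 3 / (9 * R0 ^ 5) * (\<rho> 1 \<xi> \<tau>)\<^sup>2"
    if "(\<xi>, \<tau>) \<in> \<Omega>" for \<xi> \<tau>
    using second_order[OF that] unfolding C_def D_def by blast+
  \<comment> \<open>Eliminating the other fields on all of \<open>\<Omega>\<close>, not just at the
    given point, makes \<open>P 2\<close> differentiable term by term. The quadratic term is kept as
    a product for the product rule.\<close>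
  have P_2': "P 2 \<xi> \<tau> = a0\<^sup>2 * \<rho> 2 \<xi> \<tau> + ((a0 * D - 2 * (a0 * A)) * partial1 (\<rho> 1) \<xi> \<tau>
      + - (a0 * B + a0\<^sup>2 * D) * (\<rho> 1 \<xi> \<tau> * \<rho> 1 \<xi> \<tau>))" if "(\<xi>, \<tau>) \<in> \<Omega>" for \<xi> \<tau>
  proof -
    have "P 2 \<xi> \<tau> = (- (3 * P0 / R0) * C) * \<rho> 2 \<xi> \<tau>
      + (((4 * a0 / (3 * R0) + a0 * P0\<^sup>2 / T0) * C) * partial1 (\<rho> 1) \<xi> \<tau>
      + (- (3 * P0 / R0) * ((2 * R0 ^ 3 + X - 1) * D ^ 3 / (9 * R0 ^ 5)) + 6 * P0 / R0\<^sup>2 * C\<^sup>2)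
          * (\<rho> 1 \<xi> \<tau> * \<rho> 1 \<xi> \<tau>))"
      unfolding P_2[OF that] P2_2[OF that] R_2[OF that] R1_x[OF that] R1[OF that]
      by (simp only: distrib_left distrib_right power2_eq_square mult_ac add_ac)
    then show ?thesis
      using params D by (simp only: coefficients)
  qed
  have P_2_x: "partial1 (P 2) \<xi> \<tau> = a0\<^sup>2 * partial1 (\<rho> 2) \<xi> \<tau>
      + ((a0 * D - 2 * (a0 * A)) * partial1 (partial1 (\<rho> 1)) \<xi> \<tau>
      + - (a0 * B + a0\<^sup>2 * D) * (partial1 (\<rho> 1) \<xi> \<tau> * \<rho> 1 \<xi> \<tau> + \<rho> 1 \<xi> \<tau> * partial1 (\<rho> 1) \<xi> \<tau>))"
  proof -
    note c = differentiable_on2_const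
    note sq = differentiable_on2_mult[OF d1(1) d1(1)]
    note t1 = differentiable_on2_mult[OF c d1(3)] and t2 = differentiable_on2_mult[OF c d1(2)]
      and t3 = differentiable_on2_mult[OF c sq]
    have "partial1 (P 2) \<xi> \<tau> = partial1 (\<lambda>\<xi> \<tau>. a0\<^sup>2 * \<rho> 2 \<xi> \<tau>
        + ((a0 * D - 2 * (a0 * A)) * partial1 (\<rho> 1) \<xi> \<tau>
        + - (a0 * B + a0\<^sup>2 * D) * (\<rho> 1 \<xi> \<tau> * \<rho> 1 \<xi> \<tau>))) \<xi> \<tau>"
      by (rule partial_cong(1)[OF domain p P_2'])
    then show ?thesis
      unfolding partial_add(1)[OF t1 differentiable_on2_add[OF t2 t3] p]
        partial_add(1)[OF t2 t3 p] partial_cmult(1)[OF d1(3) p] partial_cmult(1)[OF d1(2) p]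
        partial_cmult(1)[OF sq p] partial_mult(1)[OF d1(1) d1(1) p] .
  qed

  \<comment> \<open>Pullback form of the fields, their regularity and their jets\<close>
  have pull: "\<rho>E \<epsilon> = gm_pull a0 (\<epsilon> powr \<alpha>) (eps_sum N \<rho>0 (\<epsilon> powr \<alpha>) \<rho>)"
    "uE \<epsilon> = gm_pull a0 (\<epsilon> powr \<alpha>) (eps_sum N 0 (\<epsilon> powr \<alpha>) u)"
    "PE \<epsilon> = gm_pull a0 (\<epsilon> powr \<alpha>) (eps_sum N P0 (\<epsilon> powr \<alpha>) P)"
    "P2E \<epsilon> = gm_pull a0 (\<epsilon> powr \<alpha>) (eps_sum N P0 (\<epsilon> powr \<alpha>) P2)"
    "RE \<epsilon> = gm_pull a0 (\<epsilon> powr \<alpha>) (eps_sum N R0 (\<epsilon> powr \<alpha>) R)" if "0 < \<epsilon>" for \<epsilon>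
    unfolding expansions eqs by (rule gm_expansion_eq_gm_pull[OF that])+
  have tw: "twice_differentiable_on2 (eps_sum N c e f) \<Omega>" if "f \<in> {\<rho>, u, P, P2, R}" for f c e
    using domain regular[OF that] by (rule twice_differentiable_on2_eps_sum)
  have ex: "differentiable_on2 (eps_sum N c e f) \<Omega>" "differentiable_on2 (partial1 (eps_sum N c e f)) \<Omega>"
    if "f \<in> {\<rho>, u, P, P2, R}" for f c e
    using tw[OF that] by (simp_all add: twice_differentiable_on2_iff)
  have jets: "jet (\<lambda>e. eps_sum N c e f \<xi> \<tau>) c (f 1 \<xi> \<tau>) (f 2 \<xi> \<tau>)" for c f
    by (rule jet_eps_sum[OF N])
  have jet_x: "jet (\<lambda>e. partial1 (eps_sum N c e f) \<xi> \<tau>) 0 (partial1 (f 1) \<xi> \<tau>) (partial1 (f 2) \<xi> \<tau>)"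
    and jet_t: "jet (\<lambda>e. partial2 (eps_sum N c e f) \<xi> \<tau>) 0 (partial2 (f 1) \<xi> \<tau>) (partial2 (f 2) \<xi> \<tau>)"
    if "f \<in> {\<rho>, u, P, P2, R}" for c f
    by (rule jet_partial_eps_sum[OF N diff(1)[OF that] p]; assumption)+
  have jet_xx: "jet (\<lambda>e. partial1 (partial1 (eps_sum N c e f)) \<xi> \<tau>) 0
        (partial1 (partial1 (f 1)) \<xi> \<tau>) (partial1 (partial1 (f 2)) \<xi> \<tau>)"
    and jet_tx: "jet (\<lambda>e. partial2 (partial1 (eps_sum N c e f)) \<xi> \<tau>) 0
        (partial2 (partial1 (f 1)) \<xi> \<tau>) (partial2 (partial1 (f 2)) \<xi> \<tau>)"
    and jet_xt: "jet (\<lambda>e. partial1 (partial2 (eps_sum N c e f)) \<xi> \<tau>) 0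
        (partial1 (partial2 (f 1)) \<xi> \<tau>) (partial1 (partial2 (f 2)) \<xi> \<tau>)"
    and jet_tt: "jet (\<lambda>e. partial2 (partial2 (eps_sum N c e f)) \<xi> \<tau>) 0
        (partial2 (partial2 (f 1)) \<xi> \<tau>) (partial2 (partial2 (f 2)) \<xi> \<tau>)"
    if "f \<in> {\<rho>, u, P, P2, R}" for c f
    by (rule jet_partial_partial_eps_sum[OF N domain regular[OF that] p]; assumption)+
  \<comment> \<open>The mass and momentum equations start at order \<open>q + \<alpha>\<close> and
    the other three at order \<open>q\<close>, hence remainders of order 4 and 3 in
    \<open>e\<close>.\<close>
  have weight4: "(\<alpha> + \<alpha>) + 2 * \<alpha> = real 4 * \<alpha>" and weight3: "\<alpha> + 2 * \<alpha> = real 3 * \<alpha>"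
    by simp_all

  \<comment> \<open>The five model equations in turn\<close>
  have mass: "lowest_terms (\<alpha> + \<alpha>) \<alpha>
      (at_gm \<alpha> \<alpha> a0 (\<lambda>\<epsilon>. mass_residual (\<rho>E \<epsilon>) (uE \<epsilon>)) \<xi> \<tau>) 0 0"
  proof (rule lowest_terms_gm_pull[OF exponents(1) p _ _ weight4])
    show "mass_residual (\<rho>E \<epsilon>) (uE \<epsilon>) x t = gm_pull a0 (\<epsilon> powr \<alpha>)
        (gm_mass a0 (\<epsilon> powr \<alpha>) (eps_sum N \<rho>0 (\<epsilon> powr \<alpha>) \<rho>) (eps_sum N 0 (\<epsilon> powr \<alpha>) u)) x t"
      if "0 < \<epsilon>" "(x, t) \<in> gm_preimage a0 (\<epsilon> powr \<alpha>) \<Omega>" for \<epsilon> x t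
      unfolding pull[OF that(1)] by (rule mass_residual_gm_pull[OF ex(1) ex(1) that(2)]) simp_all
    show "(\<lambda>e. gm_mass a0 e (eps_sum N \<rho>0 e \<rho>) (eps_sum N 0 e u) \<xi> \<tau>) \<in> O[at_right 0](\<lambda>e. e ^ 4)"
      unfolding gm_mass_def
    proof (rule mass_jet[OF jets jet_x jet_t jets jet_x])
      show "\<rho>0 * partial1 (u 1) \<xi> \<tau> = a0 * partial1 (\<rho> 1) \<xi> \<tau>"
        unfolding u1_x[OF p] \<rho>0 using D by simp
      \<comment> \<open>As \<open>u 1\<close> is proportional to \<open>\<rho> 1\<close>, the two
        halves of the product rule coincide; this is the factor 2 in the relation for
        \<open>u 2\<close>.\<close>
      show "\<rho>0 * partial1 (u 2) \<xi> \<tau> = a0 * partial1 (\<rho> 2) \<xi> \<tau>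
          - (partial2 (\<rho> 1) \<xi> \<tau> + partial1 (\<rho> 1) \<xi> \<tau> * u 1 \<xi> \<tau> + \<rho> 1 \<xi> \<tau> * partial1 (u 1) \<xi> \<tau>)"
        unfolding u2_x u1[OF p] u1_x[OF p] by simp
    qed simp_all
  qed
  have momentum: "lowest_terms (\<alpha> + \<alpha>) \<alpha>
      (at_gm \<alpha> \<alpha> a0 (\<lambda>\<epsilon>. momentum_residual (\<rho>E \<epsilon>) (uE \<epsilon>) (PE \<epsilon>)) \<xi> \<tau>) 0 0"
  proof (rule lowest_terms_gm_pull[OF exponents(1) p _ _ weight4])
    show "momentum_residual (\<rho>E \<epsilon>) (uE \<epsilon>) (PE \<epsilon>) x t = gm_pull a0 (\<epsilon> powr \<alpha>)
        (gm_momentum a0 (\<epsilon> powr \<alpha>) (eps_sum N \<rho>0 (\<epsilon> powr \<alpha>) \<rho>) (eps_sum N 0 (\<epsilon> powr \<alpha>) u)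
          (eps_sum N P0 (\<epsilon> powr \<alpha>) P)) x t"
      if "0 < \<epsilon>" "(x, t) \<in> gm_preimage a0 (\<epsilon> powr \<alpha>) \<Omega>" for \<epsilon> x t
      unfolding pull[OF that(1)]
      by (rule momentum_residual_gm_pull[OF domain ex(1) ex(1) ex(2) ex(1) that(2)]) simp_all
    show "(\<lambda>e. gm_momentum a0 e (eps_sum N \<rho>0 e \<rho>) (eps_sum N 0 e u) (eps_sum N P0 e P) \<xi> \<tau>)
        \<in> O[at_right 0](\<lambda>e. e ^ 4)"
      unfolding gm_momentum_def
    proof (rule momentum_jet[OF jets jet_x jet_t jets jet_x jet_t jet_xx jet_x])
      show "partial1 (P 1) \<xi> \<tau> = a0 * \<rho>0 * partial1 (u 1) \<xi> \<tau>"
        by (rule P1_x)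
      \<comment> \<open>The second-order mass balance, reused to eliminate \<open>u 2\<close> from
        the momentum flux.\<close>
      have velocity2: "\<rho>0 * partial1 (u 2) \<xi> \<tau> + partial1 (\<rho> 1) \<xi> \<tau> * u 1 \<xi> \<tau> + \<rho> 1 \<xi> \<tau> * partial1 (u 1) \<xi> \<tau>
          = a0 * partial1 (\<rho> 2) \<xi> \<tau> - partial2 (\<rho> 1) \<xi> \<tau>"
        unfolding u2_x u1[OF p] u1_x[OF p] by simp
      have velocity1: "\<rho>0 * partial2 (u 1) \<xi> \<tau> = a0 * partial2 (\<rho> 1) \<xi> \<tau>"
        "2 * \<rho>0 * u 1 \<xi> \<tau> * partial1 (u 1) \<xi> \<tau> = 2 * a0\<^sup>2 * D * \<rho> 1 \<xi> \<tau> * partial1 (\<rho> 1) \<xi> \<tau>"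
        unfolding u1_t u1[OF p] u1_x[OF p] \<rho>0 using D by (simp_all add: power2_eq_square)
      show "partial1 (P 2) \<xi> \<tau>
          = a0 * (\<rho>0 * partial1 (u 2) \<xi> \<tau> + partial1 (\<rho> 1) \<xi> \<tau> * u 1 \<xi> \<tau> + \<rho> 1 \<xi> \<tau> * partial1 (u 1) \<xi> \<tau>)
            - \<rho>0 * partial2 (u 1) \<xi> \<tau> - 2 * \<rho>0 * u 1 \<xi> \<tau> * partial1 (u 1) \<xi> \<tau>
            + partial1 (partial1 (u 1)) \<xi> \<tau>"
        \<comment> \<open>The terms with \<open>\<rho> 2\<close>, those with \<open>a0 * D\<close>
          from the viscosity and those with \<open>a0 ^ 2 * D\<close> from the flux match on both
          sides. What is left is the Burgers equation times \<open>2 * a0\<close>: one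
          \<open>a0\<close> comes from \<open>velocity2\<close>, one from the
          \<open>\<tau>\<close>-derivative of \<open>u 1\<close>.\<close>
        unfolding velocity2 velocity1 u1_xx P_2_x burgers[OF p]
        by (simp add: algebra_simps power2_eq_square)
    qed simp_all
  qed
  have pressure: "lowest_terms \<alpha> \<alpha>
      (at_gm \<alpha> \<alpha> a0 (\<lambda>\<epsilon>. pressure_residual (uE \<epsilon>) (PE \<epsilon>) (P2E \<epsilon>) (RE \<epsilon>)) \<xi> \<tau>) 0 0"
  proof (rule lowest_terms_gm_pull[OF exponents(1) p _ _ weight3])
    show "pressure_residual (uE \<epsilon>) (PE \<epsilon>) (P2E \<epsilon>) (RE \<epsilon>) x t = gm_pull a0 (\<epsilon> powr \<alpha>)
        (gm_pressure a0 (\<epsilon> powr \<alpha>) (eps_sum N 0 (\<epsilon> powr \<alpha>) u) (eps_sum N P0 (\<epsilon> powr \<alpha>) P)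
          (eps_sum N P0 (\<epsilon> powr \<alpha>) P2) (eps_sum N R0 (\<epsilon> powr \<alpha>) R)) x t"
      if "0 < \<epsilon>" "(x, t) \<in> gm_preimage a0 (\<epsilon> powr \<alpha>) \<Omega>" for \<epsilon> x t
      unfolding pull[OF that(1)]
      by (rule pressure_residual_gm_pull[OF domain tw ex(1) that(2)]) simp_all
    have material: "partial1 (gm_material a0 e (eps_sum N 0 e u) (eps_sum N R0 e R)) \<xi> \<tau> =
          e * (partial1 (eps_sum N 0 e u) \<xi> \<tau> * partial1 (eps_sum N R0 e R) \<xi> \<tau>
            + (- a0 + eps_sum N 0 e u \<xi> \<tau>) * partial1 (partial1 (eps_sum N R0 e R)) \<xi> \<tau>
            + e * partial1 (partial2 (eps_sum N R0 e R)) \<xi> \<tau>)"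
      "partial2 (gm_material a0 e (eps_sum N 0 e u) (eps_sum N R0 e R)) \<xi> \<tau> =
          e * (partial2 (eps_sum N 0 e u) \<xi> \<tau> * partial1 (eps_sum N R0 e R) \<xi> \<tau>
            + (- a0 + eps_sum N 0 e u \<xi> \<tau>) * partial2 (partial1 (eps_sum N R0 e R)) \<xi> \<tau>
            + e * partial2 (partial2 (eps_sum N R0 e R)) \<xi> \<tau>)" for e
      by (rule partial_gm_material[OF tw ex(1) p]; simp)+
    show "(\<lambda>e. gm_pressure a0 e (eps_sum N 0 e u) (eps_sum N P0 e P) (eps_sum N P0 e P2) (eps_sum N R0 e R) \<xi> \<tau>)
        \<in> O[at_right 0](\<lambda>e. e ^ 3)"
      unfolding gm_pressure_def gm_material_def material
    proof (rule pressure_jet[OF jets jet_x jet_t jet_xx jet_xt jet_tx jet_tt jets jet_x jet_t])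
      \<comment> \<open>\<open>pressure_jet\<close> takes the same first-order coefficient for both
        pressures, so \<open>P 1\<close> is replaced by \<open>P2 1\<close>.\<close>
      show "jet (\<lambda>e. eps_sum N P0 e P \<xi> \<tau>) P0 (P2 1 \<xi> \<tau>) (P 2 \<xi> \<tau>)"
        using jets[of P0 P] unfolding P1(1)[OF p] .
      show "jet (\<lambda>e. eps_sum N P0 e P2 \<xi> \<tau>) P0 (P2 1 \<xi> \<tau>) (P2 2 \<xi> \<tau>)"
        by (rule jets)
      show "P 2 \<xi> \<tau> = P2 2 \<xi> \<tau> + 4 * a0 / (3 * R0) * partial1 (R 1) \<xi> \<tau>"
        by (rule P_2[OF p])
    qed (use params in simp_all)
  qed
  have gas: "lowest_terms \<alpha> \<alpha>
      (at_gm \<alpha> \<alpha> a0 (\<lambda>\<epsilon>. gas_residual \<gamma> P0 T0 R0 (uE \<epsilon>) (P2E \<epsilon>) (RE \<epsilon>)) \<xi> \<tau>) 0 0"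
  proof (rule lowest_terms_gm_pull[OF exponents(1) p _ _ weight3])
    show "gas_residual \<gamma> P0 T0 R0 (uE \<epsilon>) (P2E \<epsilon>) (RE \<epsilon>) x t = gm_pull a0 (\<epsilon> powr \<alpha>)
        (gm_gas \<gamma> P0 T0 R0 a0 (\<epsilon> powr \<alpha>) (eps_sum N 0 (\<epsilon> powr \<alpha>) u)
          (eps_sum N P0 (\<epsilon> powr \<alpha>) P2) (eps_sum N R0 (\<epsilon> powr \<alpha>) R)) x t"
      if "0 < \<epsilon>" "(x, t) \<in> gm_preimage a0 (\<epsilon> powr \<alpha>) \<Omega>" for \<epsilon> x t
      unfolding pull[OF that(1)] by (rule gas_residual_gm_pull[OF ex(1) ex(1) that(2)]) simp_all
    show "(\<lambda>e. gm_gas \<gamma> P0 T0 R0 a0 e (eps_sum N 0 e u) (eps_sum N P0 e P2) (eps_sum N R0 e R) \<xi> \<tau>)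
        \<in> O[at_right 0](\<lambda>e. e ^ 3)"
      unfolding gm_gas_def gm_material_def
    proof (rule gas_jet[OF jets jet_x jet_t jets jets jet_x jet_t])
      show "P2 1 \<xi> \<tau> = - (3 * P0 / R0) * R 1 \<xi> \<tau>"
        by (rule P1(2)[OF p])
      show "partial1 (P2 1) \<xi> \<tau> = - (3 * P0 / R0) * partial1 (R 1) \<xi> \<tau>"
        by (rule P21_x)
      show "P2 2 \<xi> \<tau> = - (3 * P0 / R0) * R 2 \<xi> \<tau> + a0 * P0\<^sup>2 / T0 * partial1 (R 1) \<xi> \<tau>
          + 6 * P0 / R0\<^sup>2 * (R 1 \<xi> \<tau>)\<^sup>2"
        by (rule P2_2[OF p])
    qed (use params in simp_all)
  qed
  have density: "lowest_terms \<alpha> \<alpha>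
      (at_gm \<alpha> \<alpha> a0 (\<lambda>\<epsilon>. density_residual X (\<rho>E \<epsilon>) (RE \<epsilon>)) \<xi> \<tau>) 0 0"
  proof (rule lowest_terms_gm_pull[OF exponents(1) p _ _ weight3])
    show "density_residual X (\<rho>E \<epsilon>) (RE \<epsilon>) x t = gm_pull a0 (\<epsilon> powr \<alpha>)
        (density_residual X (eps_sum N \<rho>0 (\<epsilon> powr \<alpha>) \<rho>) (eps_sum N R0 (\<epsilon> powr \<alpha>) R)) x t"
      if "0 < \<epsilon>" for \<epsilon> x t
      \<comment> \<open>The density relation contains no derivatives, so it commutes with the
        substitution at every point.\<close>
      unfolding pull[OF that] by (simp add: density_residual_def gm_pull_def)
    show "(\<lambda>e. density_residual X (eps_sum N \<rho>0 e \<rho>) (eps_sum N R0 e R) \<xi> \<tau>) \<in> O[at_right 0](\<lambda>e. e ^ 3)"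
      unfolding density_residual_def \<rho>0
    proof (rule density_jet[OF jets jets D_def])
      show "R 1 \<xi> \<tau> = - (D\<^sup>2 / (3 * R0\<^sup>2)) * \<rho> 1 \<xi> \<tau>"
        using R1[OF p] unfolding C_def .
      show "R 2 \<xi> \<tau> = - (D\<^sup>2 / (3 * R0\<^sup>2)) * \<rho> 2 \<xi> \<tau>
          + (2 * R0 ^ 3 + X - 1) * D ^ 3 / (9 * R0 ^ 5) * (\<rho> 1 \<xi> \<tau>)\<^sup>2"
        using R_2[OF p] unfolding C_def .
    qed (use params D in simp_all)
  qed
  show "lowest_terms (q + \<alpha>) k
      (at_gm \<alpha> \<beta> a0 (\<lambda>\<epsilon>. mass_residual (\<rho>E \<epsilon>) (uE \<epsilon>)) \<xi> \<tau>) 0 0 \<and>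
    lowest_terms (q + \<alpha>) k
      (at_gm \<alpha> \<beta> a0 (\<lambda>\<epsilon>. momentum_residual (\<rho>E \<epsilon>) (uE \<epsilon>) (PE \<epsilon>)) \<xi> \<tau>) 0 0 \<and>
    lowest_terms q k
      (at_gm \<alpha> \<beta> a0 (\<lambda>\<epsilon>. pressure_residual (uE \<epsilon>) (PE \<epsilon>) (P2E \<epsilon>) (RE \<epsilon>)) \<xi> \<tau>) 0 0 \<and>
    lowest_terms q k
      (at_gm \<alpha> \<beta> a0 (\<lambda>\<epsilon>. gas_residual \<gamma> P0 T0 R0 (uE \<epsilon>) (P2E \<epsilon>) (RE \<epsilon>)) \<xi> \<tau>) 0 0 \<and>
    lowest_terms q k
      (at_gm \<alpha> \<beta> a0 (\<lambda>\<epsilon>. density_residual X (\<rho>E \<epsilon>) (RE \<epsilon>)) \<xi> \<tau>) 0 0"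
    unfolding eqs using mass momentum pressure gas density by blast
qed

end
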